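(* Let $\Sigma$ be a Riemann surface, let $\varphi:\Sigma\to S^6\subset\mathbb{R}^7$ be a totally real minimal immersion (i.e. a conformal harmonic immersion with Kähler angle $\pi/2$), and let $F:\Sigma\to\mathbb{R}^7$ be such that $dF=\varphi\times *d\varphi$. Then the conformal immersions $F^+=F+\varphi$ and $F^-=F-\varphi$ have parallel mean curvature vector field if, and only if, up to change of orientation of $\Sigma$, either $\varphi=R_{\mathbf{v}}(\beta)\tilde\varphi$ for some unit vector $\mathbf{v}\in\mathbb{R}^7$, some angle $\beta$ and some almost complex curve $\tilde\varphi$ of type (III) with $\tilde\varphi(\Sigma)\subset S^6\cap\mathbf{v}^\perp$, or $\varphi$ is totally geodesic.
   Context: $\times$ is the $7$-dimensional cross product on $\mathbb{R}^7$: the bilinear antisymmetric product with $\mathbf{e}_i\times\mathbf{e}_j=\mathbf{e}_k$ for $(i,j,k)$ equal to, or a cyclic permutation of, one of $(1,2,3),(1,4,5),(1,7,6),(2,4,6),(2,5,7),(3,4,7),(3,6,5)$. $S^6$ is the unit sphere of $\mathbb{R}^7$. With a local conformal coordinate $z=x+iy$, $dF=\varphi\times *d\varphi$ means $F_x=\varphi\times\varphi_y$, $F_y=-\varphi\times\varphi_x$ ($F$ exists if $\Sigma$ is simply connected, and is unique up to an additive constant). The Kähler angle $\theta:\Sigma\to[0,\pi]$ of a conformal harmonic immersion $\varphi$ with conformal factor $e^{2\alpha}=|\varphi_x|^2=|\varphi_y|^2$ is given by $\cos\theta=e^{-2\alpha}\varphi\cdot(\varphi_x\times\varphi_y)$;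 thus $\varphi$ is totally real iff $\varphi\cdot(\varphi_x\times\varphi_y)=0$. The mean curvature vector field of an immersion (half the trace of its second fundamental form with respect to the first fundamental form) is parallel if its covariant derivative in the normal bundle vanishes. An almost complex curve is a non-constant smooth map $\varphi:\Sigma\to S^6$ whose differential is complex linear with respect to $J\mathbf{u}=\mathbf{x}\times\mathbf{u}$ ($\mathbf{u}\in T_{\mathbf{x}}S^6$), i.e. $\varphi_y=\varphi\times\varphi_x$. It is of type (III) if it is linearly full in some totally geodesic $S^5$ in $S^6$ (i.e. its image lies in $S^6\cap U$ for some $6$-dimensional linear subspace $U$ and in no smaller linear subspace). For a unit vector $\mathbf{v}$ and an angle $\beta$, $R_{\mathbf{v}}(\beta)\in SO(7)$ is the rotation with $R_{\mathbf{v}}(\beta)\mathbf{v}=\mathbf{v}$ and $R_{\mathbf{v}}(\beta)\mathbf{x}=\cos\beta\,\mathbf{x}+\sin\beta\,\mathbf{v}\times\mathbf{x}$ for $\mathbf{x}\in S^6\cap\mathbf{v}^\perp$. "Up to change of orientation of $\Sigma$" means after possibly replacing the complex structure of $\Sigma$ by the conjugate one. *)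

theory Defs
  imports "HOL-Analysis.Analysis"
begin

section \<open>The cross product on $R^7$\<close>

text \<open>The index \<open>7 :: 7\<close> is the same element as \<open>0\<close>, so \<open>1, \<dots>, 7\<close> enumerates the index type.\<close>

definition cross7_triples :: "(7 \<times> 7 \<times> 7) set" where
  "cross7_triples = {(1,2,3), (1,4,5), (1,7,6), (2,4,6), (2,5,7), (3,4,7), (3,6,5)}"

definition cross7_cyclic_triples :: "(7 \<times> 7 \<times> 7) set" where
  "cross7_cyclic_triples = (\<Union>(i, j, k)\<in>cross7_triples. {(i,j,k), (j,k,i), (k,i,j)})"

definition cross7 :: "real ^ 7 \<Rightarrow> real ^ 7 \<Rightarrow> real ^ 7" where
  "cross7 x y = (\<Sum>(i, j, k)\<in>cross7_cyclic_triples. (x $ i * y $ j - x $ j * y $ i) *\<^sub>R axis k 1)"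

lemma finite_cross7_cyclic_triples: "finite cross7_cyclic_triples"
  unfolding cross7_cyclic_triples_def cross7_triples_def by simp

lemma bilinear_cross7: "bilinear cross7"
  unfolding bilinear_def cross7_def
  by (auto intro!: linearI sum.cong
      simp: sum.distrib[symmetric] scaleR_right.sum algebra_simps case_prod_unfold)

lemma cross7_skew: "cross7 y x = - cross7 x y"
  unfolding cross7_def sum_negf[symmetric]
  by (rule sum.cong) (auto simp: algebra_simps)

lemma axis_nth_neq: "i \<noteq> j \<Longrightarrow> axis i x $ j = 0"
  by (simp add: axis_def)

lemma cross7_expand:
  "cross7 x y =
        (x$1 * y$2 - x$2 * y$1) *\<^sub>R axis 3 1 + (x$2 * y$3 - x$3 * y$2) *\<^sub>R axis 1 1 + (x$3 * y$1 - x$1 * y$3) *\<^sub>R axis 2 1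
      + (x$1 * y$4 - x$4 * y$1) *\<^sub>R axis 5 1 + (x$4 * y$5 - x$5 * y$4) *\<^sub>R axis 1 1 + (x$5 * y$1 - x$1 * y$5) *\<^sub>R axis 4 1
      + (x$1 * y$7 - x$7 * y$1) *\<^sub>R axis 6 1 + (x$7 * y$6 - x$6 * y$7) *\<^sub>R axis 1 1 + (x$6 * y$1 - x$1 * y$6) *\<^sub>R axis 7 1
      + (x$2 * y$4 - x$4 * y$2) *\<^sub>R axis 6 1 + (x$4 * y$6 - x$6 * y$4) *\<^sub>R axis 2 1 + (x$6 * y$2 - x$2 * y$6) *\<^sub>R axis 4 1
      + (x$2 * y$5 - x$5 * y$2) *\<^sub>R axis 7 1 + (x$5 * y$7 - x$7 * y$5) *\<^sub>R axis 2 1 + (x$7 * y$2 - x$2 * y$7) *\<^sub>R axis 5 1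
      + (x$3 * y$4 - x$4 * y$3) *\<^sub>R axis 7 1 + (x$4 * y$7 - x$7 * y$4) *\<^sub>R axis 3 1 + (x$7 * y$3 - x$3 * y$7) *\<^sub>R axis 4 1
      + (x$3 * y$6 - x$6 * y$3) *\<^sub>R axis 5 1 + (x$6 * y$5 - x$5 * y$6) *\<^sub>R axis 3 1 + (x$5 * y$3 - x$3 * y$5) *\<^sub>R axis 6 1"
  unfolding cross7_def cross7_cyclic_triples_def cross7_triples_def
  by (simp add: add.assoc)

lemma cross7_axis:
  assumes "(i, j, k) \<in> cross7_cyclic_triples"
  shows "cross7 (axis i 1) (axis j 1) = axis k 1"
  using assms unfolding cross7_cyclic_triples_def cross7_triples_def
  by (auto simp: cross7_expand axis_nth axis_nth_neq)

text \<open>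
  For a unit vector \<open>v\<close>, \<open>rot7 v \<beta>\<close> is the linear map that fixes \<open>v\<close> and sends each \<open>x\<close>
  orthogonal to \<open>v\<close> to \<open>cos \<beta> x + sin \<beta> (v \<times> x)\<close>; see the two lemmas below.
\<close>

definition rot7 :: "real ^ 7 \<Rightarrow> real \<Rightarrow> real ^ 7 \<Rightarrow> real ^ 7" where
  "rot7 v \<beta> x =
     (x \<bullet> v) *\<^sub>R v + cos \<beta> *\<^sub>R (x - (x \<bullet> v) *\<^sub>R v) + sin \<beta> *\<^sub>R cross7 v (x - (x \<bullet> v) *\<^sub>R v)"

lemma rot7_axis:
  assumes "norm v = 1"
  shows "rot7 v \<beta> v = v"
proof -
  have "v \<bullet> v = 1"
    using assms by (simp add: dot_square_norm)
  then show ?thesis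
    using bilinear_rzero[OF bilinear_cross7] by (simp add: rot7_def)
qed

lemma rot7_orthogonal:
  assumes "x \<bullet> v = 0"
  shows "rot7 v \<beta> x = cos \<beta> *\<^sub>R x + sin \<beta> *\<^sub>R cross7 v x"
  using assms by (simp add: rot7_def)


section \<open>Riemann surfaces\<close>

text \<open>
  A chart is a pair of a domain and a coordinate map; the values of the coordinate map outside
  the domain are irrelevant. The atlas need not be maximal. Second countability is not required
  since it follows from the other conditions (Rado).
\<close>

type_synonym 'a atlas = "('a set \<times> ('a \<Rightarrow> complex)) set"

definition riemann_surface :: "'a topology \<Rightarrow> 'a atlas \<Rightarrow> bool" where
  "riemann_surface X A \<longleftrightarrow>
     topspace X \<noteq> {} \<and> connected_space X \<and> Hausdorff_space X \<and>
     (\<Union>(U, \<psi>)\<in>A. U) = topspace X \<and>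
     (\<forall>(U, \<psi>)\<in>A. openin X U \<and> open (\<psi> ` U) \<and>
        homeomorphic_map (subtopology X U) (top_of_set (\<psi> ` U)) \<psi>) \<and>
     (\<forall>(U, \<psi>)\<in>A. \<forall>(V, \<eta>)\<in>A. (\<eta> \<circ> inv_into U \<psi>) holomorphic_on \<psi> ` (U \<inter> V))"

definition conj_atlas :: "'a atlas \<Rightarrow> 'a atlas" where
  "conj_atlas A = (\<lambda>(U, \<psi>). (U, cnj \<circ> \<psi>)) ` A"

definition in_coords ::
    "'a atlas \<Rightarrow> ((complex \<Rightarrow> 'b) \<Rightarrow> complex \<Rightarrow> bool) \<Rightarrow> ('a \<Rightarrow> 'b) \<Rightarrow> bool" where
  "in_coords A P f \<longleftrightarrow> (\<forall>(U, \<psi>)\<in>A. \<forall>p\<in>U. P (f \<circ> inv_into U \<psi>) (\<psi> p))"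


section \<open>Local differential geometry in a coordinate $z = x + iy$\<close>

text \<open>\<open>pd 1\<close> is the partial derivative with respect to \<open>x\<close>, and \<open>pd 2\<close> the one with respect to \<open>y\<close>.\<close>

definition pd :: "2 \<Rightarrow> (complex \<Rightarrow> 'b) \<Rightarrow> complex \<Rightarrow> 'b::real_normed_vector" where
  "pd i f z = frechet_derivative f (at z) (if i = 1 then 1 else \<i>)"

primrec Ck_on :: "nat \<Rightarrow> complex set \<Rightarrow> (complex \<Rightarrow> 'b::real_normed_vector) \<Rightarrow> bool" where
  "Ck_on 0 S f \<longleftrightarrow> continuous_on S f"
| "Ck_on (Suc k) S f \<longleftrightarrow> (\<forall>z\<in>S. f differentiable (at z)) \<and> (\<forall>i. Ck_on k S (pd i f))"

text \<open>Orthogonal projection of \<open>w\<close> onto the orthogonal complement of the span of \<open>S\<close>.\<close>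

definition normal_part :: "'b::euclidean_space set \<Rightarrow> 'b \<Rightarrow> 'b" where
  "normal_part S w = (THE n. w - n \<in> span S \<and> (\<forall>s\<in>S. n \<bullet> s = 0))"

definition tangent_basis :: "(complex \<Rightarrow> 'b::real_normed_vector) \<Rightarrow> complex \<Rightarrow> 'b set" where
  "tangent_basis f z = {pd 1 f z, pd 2 f z}"

definition first_ff :: "(complex \<Rightarrow> 'b::euclidean_space) \<Rightarrow> complex \<Rightarrow> real ^ 2 ^ 2" where
  "first_ff f z = (\<chi> i j. pd i f z \<bullet> pd j f z)"

text \<open>The second fundamental form of an immersion into Euclidean space.\<close>

definition second_ff :: "(complex \<Rightarrow> 'b::euclidean_space) \<Rightarrow> complex \<Rightarrow> 2 \<Rightarrow> 2 \<Rightarrow> 'b" where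
  "second_ff f z i j = normal_part (tangent_basis f z) (pd i (pd j f) z)"

definition mean_curvature :: "(complex \<Rightarrow> 'b::euclidean_space) \<Rightarrow> complex \<Rightarrow> 'b" where
  "mean_curvature f z =
     (1/2) *\<^sub>R (\<Sum>i\<in>UNIV. \<Sum>j\<in>UNIV. (matrix_inv (first_ff f z) $ i $ j) *\<^sub>R second_ff f z i j)"

text \<open>
  The second fundamental form of an immersion into the unit sphere: the Levi-Civita connection of
  the sphere is the Euclidean derivative projected off the position vector, so the part normal to
  the surface within the sphere is obtained by also projecting off \<open>f z\<close>.
\<close>

definition sphere_second_ff :: "(complex \<Rightarrow> 'b::euclidean_space) \<Rightarrow> complex \<Rightarrow> 2 \<Rightarrow> 2 \<Rightarrow> 'b" where
  "sphere_second_ff f z i j = normal_part (insert (f z) (tangent_basis f z)) (pd i (pd j f) z)"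

text \<open>The tension field of a map into the unit sphere, up to a positive conformal factor.\<close>

definition sphere_tension :: "(complex \<Rightarrow> 'b::euclidean_space) \<Rightarrow> complex \<Rightarrow> 'b" where
  "sphere_tension f z = normal_part {f z} (pd 1 (pd 1 f) z + pd 2 (pd 2 f) z)"

text \<open>The formula for the Kaehler angle presupposes that \<open>f\<close> is a conformal immersion into the sphere.\<close>

definition kaehler_angle :: "(complex \<Rightarrow> real ^ 7) \<Rightarrow> complex \<Rightarrow> real" where
  "kaehler_angle f z = arccos (f z \<bullet> cross7 (pd 1 f z) (pd 2 f z) / (norm (pd 1 f z))\<^sup>2)"


section \<open>Maps from a Riemann surface\<close>

definition smooth_map :: "'a atlas \<Rightarrow> ('a \<Rightarrow> 'b::real_normed_vector) \<Rightarrow> bool" where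
  "smooth_map A f \<longleftrightarrow> (\<forall>(U, \<psi>)\<in>A. \<forall>k. Ck_on k (\<psi> ` U) (f \<circ> inv_into U \<psi>))"

definition conformal_immersion :: "'a atlas \<Rightarrow> ('a \<Rightarrow> 'b::euclidean_space) \<Rightarrow> bool" where
  "conformal_immersion A f \<longleftrightarrow>
     smooth_map A f \<and>
     in_coords A (\<lambda>g z. inj (frechet_derivative g (at z))) f \<and>
     in_coords A (\<lambda>g z. pd 1 g z \<bullet> pd 2 g z = 0 \<and> norm (pd 1 g z) = norm (pd 2 g z)) f"

definition parallel_mean_curvature :: "'a atlas \<Rightarrow> ('a \<Rightarrow> 'b::euclidean_space) \<Rightarrow> bool" where
  "parallel_mean_curvature A f \<longleftrightarrow>
     in_coords A (\<lambda>g z. \<forall>i. normal_part (tangent_basis g z) (pd i (mean_curvature g) z) = 0) f"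

definition totally_real_minimal_immersion ::
    "'a topology \<Rightarrow> 'a atlas \<Rightarrow> ('a \<Rightarrow> real ^ 7) \<Rightarrow> bool" where
  "totally_real_minimal_immersion X A \<phi> \<longleftrightarrow>
     \<phi> ` topspace X \<subseteq> sphere 0 1 \<and>
     conformal_immersion A \<phi> \<and>
     in_coords A (\<lambda>g z. sphere_tension g z = 0) \<phi> \<and>
     in_coords A (\<lambda>g z. kaehler_angle g z = pi / 2) \<phi>"

definition totally_geodesic :: "'a atlas \<Rightarrow> ('a \<Rightarrow> 'b::euclidean_space) \<Rightarrow> bool" where
  "totally_geodesic A \<phi> \<longleftrightarrow> in_coords A (\<lambda>g z. \<forall>i j. sphere_second_ff g z i j = 0) \<phi>"

text \<open>\<open>dF = \<phi> \<times> *d\<phi>\<close>, that is, \<open>F\<^sub>x = \<phi> \<times> \<phi>\<^sub>y\<close> and \<open>F\<^sub>y = - \<phi> \<times> \<phi>\<^sub>x\<close> in every chart.\<close>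

definition is_cross_star_primitive ::
    "'a atlas \<Rightarrow> ('a \<Rightarrow> real ^ 7) \<Rightarrow> ('a \<Rightarrow> real ^ 7) \<Rightarrow> bool" where
  "is_cross_star_primitive A \<phi> F \<longleftrightarrow>
     (\<forall>(U, \<psi>)\<in>A. \<forall>p\<in>U.
        let f = \<phi> \<circ> inv_into U \<psi>; G = F \<circ> inv_into U \<psi>; z = \<psi> p
        in G differentiable (at z) \<and>
           pd 1 G z = cross7 (f z) (pd 2 f z) \<and>
           pd 2 G z = - cross7 (f z) (pd 1 f z))"

definition almost_complex_curve ::
    "'a topology \<Rightarrow> 'a atlas \<Rightarrow> ('a \<Rightarrow> real ^ 7) \<Rightarrow> bool" where
  "almost_complex_curve X A \<phi> \<longleftrightarrow>
     \<phi> ` topspace X \<subseteq> sphere 0 1 \<and>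
     \<not> \<phi> constant_on topspace X \<and>
     smooth_map A \<phi> \<and>
     in_coords A (\<lambda>g z. pd 2 g z = cross7 (g z) (pd 1 g z)) \<phi>"

definition type_III :: "'a topology \<Rightarrow> ('a \<Rightarrow> real ^ 7) \<Rightarrow> bool" where
  "type_III X \<phi> \<longleftrightarrow>
     (\<exists>U. subspace U \<and> dim U = 6 \<and> \<phi> ` topspace X \<subseteq> U \<and>
        (\<forall>W. subspace W \<and> W \<subset> U \<longrightarrow> \<not> \<phi> ` topspace X \<subseteq> W))"

end

theory Submission
  imports Defs
begin

text \<open>
  In a conformal coordinate put \<open>N = \<phi>\<^sub>x \<times> \<phi>\<^sub>y / |\<phi>\<^sub>x|\<^sup>2\<close> and \<open>V = \<phi> \<times> N\<close>. As \<open>\<phi>\<close> is totally real, the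
  orthogonal vectors \<open>\<phi>, \<phi>\<^sub>x, \<phi>\<^sub>y\<close> generate an orthogonal frame
  \<open>\<phi>, \<phi>\<^sub>x, \<phi>\<^sub>y, \<phi> \<times> \<phi>\<^sub>x, \<phi> \<times> \<phi>\<^sub>y, N, V\<close> of $R^7$, whose multiplication table follows from the
  identity \<open>a \<times> (a \<times> b) = (a \<bullet> b) a - (a \<bullet> a) b\<close> (locale \<open>g2_frame\<close>).

  The surfaces \<open>F \<plusminus> \<phi>\<close> have conformal factor \<open>2 |\<phi>\<^sub>x|\<^sup>2\<close>, and since \<open>\<phi>\<close> is harmonic their Laplacians
  are multiples of \<open>N \<mp> \<phi>\<close>; hence their mean curvature vectors are \<open>(N \<mp> \<phi>) / 2\<close>. The tangent planes
  of \<open>F + \<phi>\<close> and \<open>F - \<phi>\<close> are different, and asking that the derivatives of \<open>N - \<phi>\<close> and \<open>N + \<phi>\<close>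
  lie in the respective plane forces \<open>dN = - dF\<close>. Multiplying by \<open>\<phi>\<close>, this says exactly that
  \<open>dV = 0\<close> (\<open>parallel_both_iff\<close>). A holomorphic change of coordinate does not affect \<open>V\<close>, so on the
  connected surface the condition means that \<open>V\<close> is a constant unit vector \<open>v\<close>, and then \<open>\<phi>\<close> takes
  values in the orthogonal complement of \<open>v\<close>.

  Suppose \<open>V = v\<close>. The multiplication table gives \<open>\<phi>\<^sub>y = - v \<times> (\<phi> \<times> \<phi>\<^sub>x)\<close>, so \<open>\<phi>\<^sub>y\<close> arises from
  \<open>\<phi> \<times> \<phi>\<^sub>x\<close> by the rotation about \<open>v\<close> through \<open>- \<pi>/2\<close>. A rotation \<open>R\<close> about \<open>v\<close> through \<open>\<beta>\<close>
  satisfies \<open>R x \<times> R y = R\<^sup>-\<^sup>2 (x \<times> y)\<close> on suitable \<open>x, y\<close> orthogonal to \<open>v\<close> (\<open>cross7_rot7_rot7\<close>),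
  because the product on that complement is conjugate linear over the complex structure
  \<open>x \<mapsto> v \<times> x\<close>. Consequently the rotate of \<open>\<phi>\<close> through \<open>\<pi>/6\<close> is almost complex
  (\<open>rotation_almost_complex\<close>). It is full in the complement of \<open>v\<close> as soon as the second fundamental
  form is nonzero at one point, since the frame is then recovered from derivatives of \<open>\<phi>\<close>
  (\<open>full_if_not_totally_geodesic\<close>).

  Conversely, if \<open>\<phi>\<close> is the rotate of an almost complex curve through an angle \<open>\<beta>\<close>, the same law gives
  \<open>\<phi>\<^sub>y = \<plusminus> (cos 3\<beta> (\<phi> \<times> \<phi>\<^sub>x) + sin 3\<beta> v \<times> (\<phi> \<times> \<phi>\<^sub>x))\<close>. Total reality removes the cosine, and
  then \<open>V = \<mp> sin 3\<beta> v\<close> is constant. If \<open>\<phi>\<close> is totally geodesic, differentiating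
  \<open>|\<phi>\<^sub>x|\<^sup>2 N = \<phi>\<^sub>x \<times> \<phi>\<^sub>y\<close> gives \<open>dN = - dF\<close> directly. Reversing the orientation only changes the sign
  in the almost complex equation, which the converse argument allows.
\<close>

section \<open>Algebra of the cross product\<close>

lemma exhaust_7: "x = 1 \<or> x = 2 \<or> x = 3 \<or> x = 4 \<or> x = 5 \<or> x = 6 \<or> x = 7" for x :: 7
proof (induct x)
  case (of_int z)
  then have "z = 0 \<or> z = 1 \<or> z = 2 \<or> z = 3 \<or> z = 4 \<or> z = 5 \<or> z = 6"
    by fastforce
  then show ?case by auto
qed

lemma UNIV_7: "(UNIV :: 7 set) = {1,2,3,4,5,6,7}"
  using exhaust_7 by auto

lemma sum_7: "sum f (UNIV :: 7 set) = f 1 + f 2 + f 3 + f 4 + f 5 + f 6 + f 7"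
  unfolding UNIV_7 by (simp add: ac_simps)

lemma forall_7: "(\<forall>i::7. P i) \<longleftrightarrow> P 1 \<and> P 2 \<and> P 3 \<and> P 4 \<and> P 5 \<and> P 6 \<and> P 7"
  by (metis exhaust_7)

lemma cross7_nth:
  "cross7 x y $ 1 = (x$2*y$3 - x$3*y$2) + (x$4*y$5-x$5*y$4) + (x$7*y$6-x$6*y$7)"
  "cross7 x y $ 2 = (x$3*y$1 - x$1*y$3) + (x$4*y$6-x$6*y$4) + (x$5*y$7-x$7*y$5)"
  "cross7 x y $ 3 = (x$1*y$2 - x$2*y$1) + (x$4*y$7-x$7*y$4) + (x$6*y$5-x$5*y$6)"
  "cross7 x y $ 4 = (x$5*y$1 - x$1*y$5) + (x$6*y$2-x$2*y$6) + (x$7*y$3-x$3*y$7)"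
  "cross7 x y $ 5 = (x$1*y$4 - x$4*y$1) + (x$7*y$2-x$2*y$7) + (x$3*y$6-x$6*y$3)"
  "cross7 x y $ 6 = (x$1*y$7 - x$7*y$1) + (x$2*y$4-x$4*y$2) + (x$5*y$3-x$3*y$5)"
  "cross7 x y $ 7 = (x$6*y$1 - x$1*y$6) + (x$2*y$5-x$5*y$2) + (x$3*y$4-x$4*y$3)"
  by (simp_all add: cross7_expand axis_nth axis_nth_neq)

interpretation cross7: bounded_bilinear cross7
  using bilinear_cross7 bilinear_conv_bounded_bilinear by blast

lemma cross7_self [simp]: "cross7 a a = 0"
  by (simp add: vec_eq_iff forall_7 cross7_nth)

lemma inner_cross7_cyclic: "a \<bullet> cross7 b c = b \<bullet> cross7 c a"
  by (simp add: inner_vec_def sum_7 cross7_nth algebra_simps)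

lemma inner_cross7_skew: "cross7 a b \<bullet> c = - (b \<bullet> cross7 a c)"
  by (metis inner_commute inner_cross7_cyclic cross7_skew inner_minus_right)

lemma inner_cross7_same [simp]:
  "a \<bullet> cross7 a b = 0" "b \<bullet> cross7 a b = 0" "cross7 a b \<bullet> a = 0" "cross7 a b \<bullet> b = 0"
  using inner_cross7_cyclic[of a a b] inner_cross7_cyclic[of a b a] inner_cross7_cyclic[of b a b]
  by (simp_all add: inner_commute cross7_skew[of b a])

text \<open>
  The only identity that uses more than bilinearity and the alternation of \<open>a \<bullet> (b \<times> c)\<close>. It expresses
  that the octonions are alternative, and the rest of the algebra is derived from it.
\<close>

lemma cross7_cross7_same: "cross7 a (cross7 a b) = (a \<bullet> b) *\<^sub>R a - (a \<bullet> a) *\<^sub>R b"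
  by (simp add: vec_eq_iff forall_7 inner_vec_def sum_7 cross7_nth algebra_simps)

lemma cross7_cross7_polarized:
  "cross7 a (cross7 b c) + cross7 b (cross7 a c)
     = (a \<bullet> c) *\<^sub>R b + (b \<bullet> c) *\<^sub>R a - (2 * (a \<bullet> b)) *\<^sub>R c"
  using cross7_cross7_same[of "a + b" c] cross7_cross7_same[of a c] cross7_cross7_same[of b c]
  by (simp add: cross7.add_left cross7.add_right inner_add_left inner_add_right inner_commute
      algebra_simps)

lemma inner_cross7_cross7: "cross7 a b \<bullet> cross7 a c = (a \<bullet> a) * (b \<bullet> c) - (a \<bullet> b) * (a \<bullet> c)"
proof -
  have "cross7 a b \<bullet> cross7 a c = - (c \<bullet> cross7 a (cross7 a b))"
    using inner_cross7_cyclic[of "cross7 a b" a c] inner_cross7_cyclic[of a c "cross7 a b"]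
    by (simp add: cross7_skew[of "cross7 a b" a] cross7.minus_right inner_commute)
  then show ?thesis
    by (simp add: cross7_cross7_same inner_diff_right inner_commute)
qed

text \<open>
  The replacement for associativity: orthogonal left multiplications anticommute up to the polarized
  terms, all of which vanish here.
\<close>

lemma cross7_anticommute_orthogonal:
  assumes "a \<bullet> b = 0" "a \<bullet> c = 0" "b \<bullet> c = 0"
  shows "cross7 a (cross7 b c) = - cross7 b (cross7 a c)"
  using cross7_cross7_polarized[of a b c] assms by (simp add: eq_neg_iff_add_eq_0)

section \<open>Rotations about a unit vector\<close>

lemma linear_rot7: "linear (rot7 v \<beta>)"
  by (rule linearI)
    (simp_all add: rot7_def inner_add_left cross7.add_right cross7.diff_right cross7.scaleR_right
      algebra_simps)

lemma rot7_eq: "rot7 v \<beta> x = (x \<bullet> v) *\<^sub>R v + cos \<beta> *\<^sub>R (x - (x \<bullet> v) *\<^sub>R v) + sin \<beta> *\<^sub>R cross7 v x"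
  by (simp add: rot7_def cross7.diff_right cross7.scaleR_right)

lemma rot7_zero [simp]: "rot7 v 0 x = x"
  by (simp add: rot7_eq)

lemma inner_rot7: "rot7 v \<beta> x \<bullet> y = x \<bullet> rot7 v (-\<beta>) y"
  by (simp add: rot7_eq inner_simps inner_commute[of v y] inner_cross7_skew algebra_simps)

lemma bounded_linear_rot7: "bounded_linear (rot7 v \<beta>)"
  using linear_rot7 by (simp add: linear_conv_bounded_linear)

context
  fixes v :: "real ^ 7"
  assumes unit: "norm v = 1"
begin

lemma rot7_inner_axis: "rot7 v \<beta> x \<bullet> v = x \<bullet> v"
  using rot7_axis[OF unit, of "- \<beta>"] by (simp add: inner_rot7)

lemma rot7_rot7: "rot7 v \<alpha> (rot7 v \<beta> x) = rot7 v (\<alpha> + \<beta>) x"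
proof -
  have vv: "v \<bullet> v = 1"
    using unit by (simp add: dot_square_norm)
  have 1: "cross7 v (rot7 v \<beta> x) = cos \<beta> *\<^sub>R cross7 v x - sin \<beta> *\<^sub>R (x - (x \<bullet> v) *\<^sub>R v)"
    by (simp add: rot7_eq cross7.add_right cross7.diff_right cross7.scaleR_right
        cross7_cross7_same vv inner_commute algebra_simps)
  show ?thesis
    by (simp add: rot7_eq[of v \<alpha>] rot7_inner_axis 1)
      (simp add: rot7_eq sin_add cos_add algebra_simps)
qed

lemma inner_rot7_rot7: "rot7 v \<beta> x \<bullet> rot7 v \<beta> y = x \<bullet> y"
  by (simp add: inner_rot7 rot7_rot7)

text \<open>
  Write \<open>J x = v \<times> x\<close>. On orthogonal \<open>x, y\<close> in the complement of \<open>v\<close> with \<open>x \<times> y\<close> orthogonal to \<open>v\<close>,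
  the product is conjugate linear for \<open>J\<close>: \<open>J x \<times> y = x \<times> J y = - J (x \<times> y)\<close>. Since the rotation is
  \<open>cos \<beta> + sin \<beta> J\<close>, it comes out of each of the two slots with its angle reversed.
\<close>

lemma cross7_rot7_rot7:
  assumes xv: "x \<bullet> v = 0" and yv: "y \<bullet> v = 0" and xy: "x \<bullet> y = 0"
    and xyv: "cross7 x y \<bullet> v = 0"
  shows "cross7 (rot7 v \<beta> x) (rot7 v \<beta> y) = rot7 v (- 2 * \<beta>) (cross7 x y)"
proof -
  have vv: "v \<bullet> v = 1"
    using unit by (simp add: dot_square_norm)
  (* This is the assumption on x \<times> y, moved across by cyclicity; it is needed to reorder J x \<times> J y. *)
  have xJy: "x \<bullet> cross7 v y = 0"
    using inner_cross7_cyclic[of v x y] inner_cross7_cyclic[of x v y] xyv cross7_skew[of y v]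
    by (simp add: inner_commute)
  have 1: "cross7 x (cross7 v y) = - cross7 v (cross7 x y)"
    using assms by (intro cross7_anticommute_orthogonal) (simp_all add: inner_commute)
  have 2: "cross7 (cross7 v x) y = - cross7 v (cross7 x y)"
    using cross7_anticommute_orthogonal[of y v x] cross7_skew[of y x] assms
      cross7_skew[of "cross7 v x" y]
    by (simp add: inner_commute cross7.minus_right)
  have "cross7 (cross7 v x) (cross7 v y) = - cross7 (cross7 v y) (cross7 v x)"
    by (rule cross7_skew)
  also have "cross7 (cross7 v y) (cross7 v x) = - cross7 v (cross7 (cross7 v y) x)"
    using xv yv xJy by (intro cross7_anticommute_orthogonal) (simp_all add: inner_commute)
  also have "cross7 (cross7 v y) x = cross7 v (cross7 x y)"
    using 1 cross7_skew[of "cross7 v y" x] by simp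
  finally have 3: "cross7 (cross7 v x) (cross7 v y) = - cross7 x y"
    using xyv vv by (simp add: cross7_cross7_same inner_commute)
  have "cross7 (rot7 v \<beta> x) (rot7 v \<beta> y)
      = (cos \<beta> * cos \<beta>) *\<^sub>R cross7 x y - (sin \<beta> * sin \<beta>) *\<^sub>R cross7 x y
        - (sin \<beta> * cos \<beta>) *\<^sub>R cross7 v (cross7 x y) - (cos \<beta> * sin \<beta>) *\<^sub>R cross7 v (cross7 x y)"
    by (simp add: rot7_orthogonal xv yv cross7.add_left cross7.add_right cross7.scaleR_left
        cross7.scaleR_right 1 2 3 scaleR_add_right scaleR_right_diff_distrib)
  also have "\<dots> = (cos \<beta> * cos \<beta> - sin \<beta> * sin \<beta>) *\<^sub>R cross7 x y
        - (sin \<beta> * cos \<beta> + cos \<beta> * sin \<beta>) *\<^sub>R cross7 v (cross7 x y)"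
    by (simp only: scaleR_left_diff_distrib scaleR_left_distrib diff_diff_add add.assoc)
  also have "\<dots> = rot7 v (- 2 * \<beta>) (cross7 x y)"
    using xyv by (simp add: rot7_orthogonal cos_double sin_double power2_eq_square)
  finally show ?thesis .
qed

end

section \<open>Frames generated by three orthogonal vectors\<close>

lemma span_pair: "x \<in> span {p, q} \<longleftrightarrow> (\<exists>k l. x = k *\<^sub>R p + l *\<^sub>R q)"
proof
  assume "x \<in> span {p, q}"
  then obtain k where "x - k *\<^sub>R p \<in> span {q}"
    unfolding span_breakdown_eq by blast
  then obtain l where "x - k *\<^sub>R p = l *\<^sub>R q"
    unfolding span_singleton by blast
  then have "x = k *\<^sub>R p + l *\<^sub>R q"
    by (metis add.commute diff_eq_eq)
  then show "\<exists>k l. x = k *\<^sub>R p + l *\<^sub>R q"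
    by blast
next
  assume "\<exists>k l. x = k *\<^sub>R p + l *\<^sub>R q"
  then show "x \<in> span {p, q}"
    by (auto intro!: span_add span_scale intro: span_base)
qed

lemma sorted_wrt_irrefl_imp_distinct:
  "sorted_wrt P xs \<Longrightarrow> (\<And>x. x \<in> set xs \<Longrightarrow> \<not> P x x) \<Longrightarrow> distinct xs"
  by (induct xs) auto

text \<open>
  The values \<open>f = \<phi>\<close>, \<open>a = \<phi>\<^sub>x\<close>, \<open>b = \<phi>\<^sub>y\<close> of a totally real conformal immersion at a point, where \<open>w\<close> is
  the conformal factor. Leaving \<open>a\<close> and \<open>b\<close> unnormalized avoids square roots.
\<close>

locale g2_frame =
  fixes f a b :: "real ^ 7" and w :: real
  assumes ff: "f \<bullet> f = 1" and fa: "f \<bullet> a = 0" and fb: "f \<bullet> b = 0" and ab: "a \<bullet> b = 0"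
    and aa: "a \<bullet> a = w" and bb: "b \<bullet> b = w" and w_pos: "w > 0"
    and fab: "f \<bullet> cross7 a b = 0"
begin

lemma swapped: "b \<bullet> a = 0" "a \<bullet> f = 0" "b \<bullet> f = 0"
  using ab fa fb by (simp_all add: inner_commute)

lemma inner_triple [simp]:
  "cross7 a b \<bullet> f = 0" "a \<bullet> cross7 f b = 0" "b \<bullet> cross7 f a = 0"
  "cross7 f b \<bullet> a = 0" "cross7 f a \<bullet> b = 0"
  using fab inner_cross7_cyclic[of f a b] inner_cross7_cyclic[of f b a] cross7_skew[of b a]
    cross7_skew[of a f] cross7_skew[of b f]
  by (simp_all add: inner_commute)

lemmas basic = ff fa fb ab aa bb fab swapped

lemma double_cross:
  "cross7 f (cross7 f a) = - a" "cross7 f (cross7 f b) = - b"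
  "cross7 f (cross7 f (cross7 a b)) = - cross7 a b"
  "cross7 a (cross7 a b) = - w *\<^sub>R b" "cross7 b (cross7 a b) = w *\<^sub>R a"
  using cross7_cross7_same[of b a] cross7_skew[of b a]
  by (simp_all add: cross7_cross7_same basic cross7.minus_right)

lemma cross_b_fa: "cross7 b (cross7 f a) = cross7 f (cross7 a b)"
  using cross7_anticommute_orthogonal[of f b a] cross7_skew[of b a]
  by (simp add: basic cross7.minus_right)

text \<open>
  With \<open>v\<close> the normalized last vector of the frame this reads \<open>b = - v \<times> (f \<times> a)\<close>, the relation behind the
  rotation angle \<open>\<pi>/6\<close>.
\<close>

lemma axis_cross_fa: "cross7 (cross7 f (cross7 a b)) (cross7 f a) = - w *\<^sub>R b"
  using cross7_cross7_same[of "cross7 f a" b]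
    cross7_skew[of "cross7 b (cross7 f a)" "cross7 f a"] cross7_skew[of b "cross7 f a"]
  by (simp add: cross_b_fa[symmetric] inner_cross7_cross7 basic cross7.minus_left cross7.minus_right)

lemma inner_products:
  "cross7 f a \<bullet> cross7 f b = 0" "cross7 f a \<bullet> cross7 f a = w" "cross7 f b \<bullet> cross7 f b = w"
  "cross7 a b \<bullet> cross7 a b = w\<^sup>2" "cross7 f a \<bullet> cross7 a b = 0" "cross7 f b \<bullet> cross7 a b = 0"
  "cross7 f (cross7 a b) \<bullet> cross7 f (cross7 a b) = w\<^sup>2"
  "cross7 f (cross7 a b) \<bullet> cross7 f a = 0" "cross7 f (cross7 a b) \<bullet> cross7 f b = 0"
  "cross7 f (cross7 a b) \<bullet> a = 0" "cross7 f (cross7 a b) \<bullet> b = 0"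
  "cross7 f (cross7 a b) \<bullet> cross7 a b = 0"
proof -
  show 1: "cross7 a b \<bullet> cross7 a b = w\<^sup>2"
    by (simp add: inner_cross7_cross7 basic power2_eq_square)
  show "cross7 f a \<bullet> cross7 a b = 0" "cross7 f b \<bullet> cross7 a b = 0"
    using inner_cross7_cross7[of a f b] inner_cross7_cross7[of b f a]
    by (simp_all add: basic cross7_skew[of a f] cross7_skew[of b f] cross7_skew[of b a])
  show "cross7 f (cross7 a b) \<bullet> a = 0" "cross7 f (cross7 a b) \<bullet> b = 0"
    using inner_cross7_cyclic[of a f "cross7 a b"] inner_cross7_cyclic[of b f "cross7 a b"]
      cross7_skew[of "cross7 a b" a] cross7_skew[of "cross7 a b" b]
    by (simp_all add: inner_commute double_cross basic)
qed (simp_all add: inner_cross7_cross7 basic power2_eq_square)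

lemmas inner_products_commuted = inner_products[THEN trans[OF inner_commute]]

text \<open>
  Otherwise \<open>n\<close> and the seven frame vectors would be eight nonzero pairwise orthogonal vectors in $R^7$.
\<close>

lemma complete:
  assumes "n \<bullet> f = 0" "n \<bullet> a = 0" "n \<bullet> b = 0" "n \<bullet> cross7 f a = 0" "n \<bullet> cross7 f b = 0"
    "n \<bullet> cross7 a b = 0" "n \<bullet> cross7 f (cross7 a b) = 0"
  shows "n = 0"
proof (rule ccontr)
  assume n: "n \<noteq> 0"
  let ?L = "[n, f, a, b, cross7 f a, cross7 f b, cross7 a b, cross7 f (cross7 a b)]"
  have self: "x \<bullet> x \<noteq> 0" if "x \<in> set ?L" for x
    using that n w_pos by (auto simp: basic inner_products simp del: inner_eq_zero_iff) simp
  have orth: "sorted_wrt (\<lambda>x y. x \<bullet> y = 0) ?L"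
    using assms by (simp add: basic inner_products inner_products_commuted)
  have dist: "distinct ?L"
    by (rule sorted_wrt_irrefl_imp_distinct[OF orth]) (use self in blast)
  have "pairwise orthogonal (set ?L)"
    using orth by (auto simp: pairwise_def orthogonal_def inner_commute)
  moreover have "0 \<notin> set ?L"
    using self by fastforce
  ultimately have "independent (set ?L)"
    by (rule pairwise_orthogonal_independent)
  then have "card (set ?L) \<le> DIM(real ^ 7)"
    using independent_bound by blast
  then show False
    using distinct_card[OF dist] by simp
qed

lemma decompose:
  assumes "u \<bullet> cross7 a b = 0" "u \<bullet> cross7 f (cross7 a b) = 0"
  shows "w *\<^sub>R u = (w * (u \<bullet> f)) *\<^sub>R f + (u \<bullet> a) *\<^sub>R a + (u \<bullet> b) *\<^sub>R b
           + (u \<bullet> cross7 f a) *\<^sub>R cross7 f a + (u \<bullet> cross7 f b) *\<^sub>R cross7 f b" (is "_ = ?r")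
proof -
  have "w *\<^sub>R u - ?r = 0"
    by (intro complete) (simp_all add: inner_diff_left inner_add_left basic assms
      inner_products inner_products_commuted)
  then show ?thesis by simp
qed

text \<open>
  The two planes are the tangent planes of \<open>F + \<phi>\<close> and \<open>F - \<phi>\<close>. Their spanning vectors have the same components
  along \<open>f \<times> a, f \<times> b\<close> and opposite components along \<open>a, b\<close>. Comparing the two expressions for \<open>u\<close> along
  \<open>f \<times> a, f \<times> b\<close> identifies the coefficients, and comparing along \<open>a, b\<close> then determines them.
\<close>

lemma span_coefficients:
  assumes "u - (s *\<^sub>R a + t *\<^sub>R b) \<in> span {cross7 f b + a, - cross7 f a + b}"
    and "u + (s *\<^sub>R a + t *\<^sub>R b) \<in> span {cross7 f b - a, - cross7 f a - b}"
  shows "u = - s *\<^sub>R cross7 f b + t *\<^sub>R cross7 f a"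
proof -
  obtain p q where 1: "u - (s *\<^sub>R a + t *\<^sub>R b) = p *\<^sub>R (cross7 f b + a) + q *\<^sub>R (- cross7 f a + b)"
    using assms(1) span_pair by blast
  obtain p' q' where 2: "u + (s *\<^sub>R a + t *\<^sub>R b) = p' *\<^sub>R (cross7 f b - a) + q' *\<^sub>R (- cross7 f a - b)"
    using assms(2) span_pair by blast
  note ip = inner_simps basic inner_products inner_products_commuted
  have "u \<bullet> a - s * w = p * w" "u \<bullet> b - t * w = q * w" "u \<bullet> cross7 f a = - q * w" "u \<bullet> cross7 f b = p * w"
    using arg_cong[OF 1, of "\<lambda>x. x \<bullet> a"] arg_cong[OF 1, of "\<lambda>x. x \<bullet> b"]
      arg_cong[OF 1, of "\<lambda>x. x \<bullet> cross7 f a"] arg_cong[OF 1, of "\<lambda>x. x \<bullet> cross7 f b"]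
    by (simp_all add: ip)
  moreover have "u \<bullet> a + s * w = - p' * w" "u \<bullet> b + t * w = - q' * w" "u \<bullet> cross7 f a = - q' * w"
      "u \<bullet> cross7 f b = p' * w"
    using arg_cong[OF 2, of "\<lambda>x. x \<bullet> a"] arg_cong[OF 2, of "\<lambda>x. x \<bullet> b"]
      arg_cong[OF 2, of "\<lambda>x. x \<bullet> cross7 f a"] arg_cong[OF 2, of "\<lambda>x. x \<bullet> cross7 f b"]
    by (simp_all add: ip)
  ultimately have "p * w + s * w = 0" "q * w + t * w = 0"
    by linarith+
  then have "(p + s) * w = 0" "(q + t) * w = 0"
    by (simp_all only: distrib_right)
  then have "p = - s" "q = - t"
    using w_pos by (simp_all add: eq_neg_iff_add_eq_0)
  then show ?thesis
    using 1 by (simp add: algebra_simps)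
qed

lemma opposite_spans_iff:
  "u - a \<in> span {cross7 f b + a, - cross7 f a + b} \<and> u + a \<in> span {cross7 f b - a, - cross7 f a - b}
    \<longleftrightarrow> u = - cross7 f b"
  "u - b \<in> span {cross7 f b + a, - cross7 f a + b} \<and> u + b \<in> span {cross7 f b - a, - cross7 f a - b}
    \<longleftrightarrow> u = cross7 f a"
proof -
  have in_span: "- p \<in> span {p, q}" "- q \<in> span {p, q}" for p q :: "real ^ 7"
    by (auto intro: span_neg span_base)
  have eqs: "- cross7 f b - a = - (cross7 f b + a)" "- cross7 f b + a = - (cross7 f b - a)"
    "cross7 f a - b = - (- cross7 f a + b)" "cross7 f a + b = - (- cross7 f a - b)"
    by simp_all
  show "u - a \<in> span {cross7 f b + a, - cross7 f a + b} \<and> u + a \<in> span {cross7 f b - a, - cross7 f a - b}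
    \<longleftrightarrow> u = - cross7 f b" (is "?L \<longleftrightarrow> ?R")
  proof
    assume ?R then show ?L by (simp only: eqs in_span simp_thms)
  qed (use span_coefficients[of u 1 0] in simp)
  show "u - b \<in> span {cross7 f b + a, - cross7 f a + b} \<and> u + b \<in> span {cross7 f b - a, - cross7 f a - b}
    \<longleftrightarrow> u = cross7 f a" (is "?L \<longleftrightarrow> ?R")
  proof
    assume ?R then show ?L by (simp only: eqs in_span simp_thms)
  qed (use span_coefficients[of u 0 1] in simp)
qed

end

section \<open>Partial derivatives in a complex coordinate\<close>

lemma pd_eqI:
  "(f has_derivative D) (at z) \<Longrightarrow> pd i f z = D (if i = 1 then 1 else \<i>)"
  unfolding pd_def by (metis frechet_derivative_at)

lemmas frechet_derivative_worksI = frechet_derivative_works[THEN iffD1]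

lemma frechet_derivative_pd:
  assumes "f differentiable (at z)"
  shows "frechet_derivative f (at z) h = Re h *\<^sub>R pd 1 f z + Im h *\<^sub>R pd 2 f z"
proof -
  interpret linear "frechet_derivative f (at z)"
    using assms by (rule linear_frechet_derivative)
  have "h = Re h *\<^sub>R 1 + Im h *\<^sub>R \<i>"
    by (simp add: complex_eq_iff)
  then have "frechet_derivative f (at z) h = frechet_derivative f (at z) (Re h *\<^sub>R 1 + Im h *\<^sub>R \<i>)"
    by simp
  then show ?thesis
    by (simp only: add scaleR pd_def) simp
qed

lemma has_derivative_pd:
  assumes "f differentiable (at z)"
  shows "(f has_derivative (\<lambda>h. Re h *\<^sub>R pd 1 f z + Im h *\<^sub>R pd 2 f z)) (at z)"
  using assms frechet_derivative_pd[OF assms, abs_def] frechet_derivative_works by metis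

text \<open>
  A map read in a chart is meaningful only on the image of the chart, so derivatives must be computed from
  identities that hold on an open set only.
\<close>

lemma
  assumes "open S" "z \<in> S" "\<And>w. w \<in> S \<Longrightarrow> f w = g w"
  shows pd_cong_open: "pd i f z = pd i g z"
    and differentiable_cong_open: "f differentiable (at z) \<longleftrightarrow> g differentiable (at z)"
proof -
  have "(f has_derivative D) (at z) \<longleftrightarrow> (g has_derivative D) (at z)" for D
    using assms has_derivative_transform_within_open by metis
  then show "pd i f z = pd i g z" "f differentiable (at z) \<longleftrightarrow> g differentiable (at z)"
    by (simp_all add: pd_def frechet_derivative_def differentiable_def)
qed

lemma pd_const [simp]: "pd i (\<lambda>z. c) z = 0"
  by (rule pd_eqI) (rule has_derivative_const)

lemma pd_eq_0_open:
  assumes "open S" "z \<in> S" "\<And>w. w \<in> S \<Longrightarrow> f w = c"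
  shows "pd i f z = 0"
  using pd_cong_open[OF assms] by simp

lemma (in bounded_bilinear) pd_prod:
  assumes "f differentiable (at z)" "g differentiable (at z)"
  shows "pd i (\<lambda>w. prod (f w) (g w)) z = prod (pd i f z) (g z) + prod (f z) (pd i g z)"
  using pd_eqI[OF FDERIV[OF assms[THEN frechet_derivative_worksI]]]
  by (simp add: pd_def add.commute)

lemma (in bounded_bilinear) differentiable_prod:
  assumes "f differentiable (at z)" "g differentiable (at z)"
  shows "(\<lambda>w. prod (f w) (g w)) differentiable (at z)"
  using FDERIV[OF assms[THEN frechet_derivative_worksI]] differentiableI by blast

lemma (in bounded_linear) pd_linear:
  "g differentiable (at z) \<Longrightarrow> pd i (\<lambda>w. f (g w)) z = f (pd i g z)"
  using pd_eqI[OF has_derivative[OF frechet_derivative_worksI]] by (simp add: pd_def)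

lemma pd_add:
  assumes "f differentiable (at z)" "g differentiable (at z)"
  shows "pd i (\<lambda>w. f w + g w) z = pd i f z + pd i g z"
  using pd_eqI[OF has_derivative_add[OF assms[THEN frechet_derivative_worksI]]] by (simp add: pd_def)

lemma pd_diff:
  assumes "f differentiable (at z)" "g differentiable (at z)"
  shows "pd i (\<lambda>w. f w - g w) z = pd i f z - pd i g z"
  using pd_eqI[OF has_derivative_diff[OF assms[THEN frechet_derivative_worksI]]] by (simp add: pd_def)

lemmas pd_scaleR_right = bounded_linear.pd_linear[OF bounded_linear_scaleR_right]
lemmas pd_inner = bounded_bilinear.pd_prod[OF bounded_bilinear_inner]
lemmas pd_scaleR = bounded_bilinear.pd_prod[OF bounded_bilinear_scaleR]
lemmas pd_cross7 = cross7.pd_prod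

section \<open>Smooth maps\<close>

text \<open>
  Needed because the product and chain rules give the partial derivatives on \<open>S\<close> only, whereas \<open>Ck_on\<close>
  iterates over the total functions \<open>pd i f\<close>.
\<close>

lemma Ck_on_cong:
  "open S \<Longrightarrow> (\<And>z. z \<in> S \<Longrightarrow> f z = g z) \<Longrightarrow> Ck_on k S f \<longleftrightarrow> Ck_on k S g"
proof (induction k arbitrary: f g)
  case 0
  then show ?case by (simp cong: continuous_on_cong)
next
  case (Suc k)
  have "Ck_on k S (pd i f) \<longleftrightarrow> Ck_on k S (pd i g)" for i
    using Suc by (intro Suc.IH pd_cong_open[of S]) auto
  moreover have "f differentiable (at z) \<longleftrightarrow> g differentiable (at z)" if "z \<in> S" for z
    using Suc that by (intro differentiable_cong_open[of S]) auto
  ultimately show ?case by simp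
qed

lemma Ck_on_SucD: "Ck_on (Suc k) S f \<Longrightarrow> Ck_on k S f"
proof (induction k arbitrary: f)
  case 0
  then show ?case
    by (auto intro!: continuous_at_imp_continuous_on differentiable_imp_continuous_within)
qed auto

lemma Ck_on_add:
  assumes "open S"
  shows "Ck_on k S f \<Longrightarrow> Ck_on k S g \<Longrightarrow> Ck_on k S (\<lambda>z. f z + g z)"
proof (induction k arbitrary: f g)
  case 0
  then show ?case by (simp add: continuous_on_add)
next
  case (Suc k)
  have "Ck_on k S (pd i (\<lambda>z. f z + g z)) \<longleftrightarrow> Ck_on k S (\<lambda>z. pd i f z + pd i g z)" for i
    using Suc.prems assms by (intro Ck_on_cong) (auto simp: pd_add)
  then show ?case
    using Suc by (auto intro!: differentiable_add)
qed

lemma (in bounded_linear) Ck_on_linear: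
  assumes "open S"
  shows "Ck_on k S g \<Longrightarrow> Ck_on k S (\<lambda>z. f (g z))"
proof (induction k arbitrary: g)
  case 0
  then show ?case by (simp add: continuous_on)
next
  case (Suc k)
  have "Ck_on k S (pd i (\<lambda>z. f (g z))) \<longleftrightarrow> Ck_on k S (\<lambda>z. f (pd i g z))" for i
    using Suc.prems assms by (intro Ck_on_cong) (auto simp: pd_linear)
  moreover have "(\<lambda>z. f (g z)) differentiable (at z)" if "z \<in> S" for z
    using Suc.prems that has_derivative[of g] unfolding differentiable_def by (metis Ck_on.simps(2) differentiable_def)
  ultimately show ?case
    using Suc by auto
qed

lemma (in bounded_bilinear) Ck_on_prod:
  assumes "open S"
  shows "Ck_on k S f \<Longrightarrow> Ck_on k S g \<Longrightarrow> Ck_on k S (\<lambda>z. prod (f z) (g z))"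
proof (induction k arbitrary: f g)
  case 0
  then show ?case by (simp add: continuous_on)
next
  case (Suc k)
  have "Ck_on k S (pd i (\<lambda>z. prod (f z) (g z)))
      \<longleftrightarrow> Ck_on k S (\<lambda>z. prod (pd i f z) (g z) + prod (f z) (pd i g z))" for i
    using Suc.prems assms by (intro Ck_on_cong) (auto simp: pd_prod)
  moreover have "Ck_on k S f" "Ck_on k S g"
    using Suc.prems Ck_on_SucD by blast+
  ultimately show ?case
    using Suc assms by (auto intro!: differentiable_prod Ck_on_add)
qed

section \<open>Symmetry of second partial derivatives\<close>

text \<open>
  The second difference over a square of side \<open>h\<close> is an increment, over a segment of length \<open>h\<close> in direction
  \<open>i\<close>, of a function whose derivative is a difference of values of \<open>pd i f\<close>. Differentiability of \<open>pd i f\<close> at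
  \<open>z\<close> approximates that derivative by \<open>h\<close> times \<open>pd j (pd i f) z\<close>, and the mean value inequality does the rest.
\<close>

lemma second_difference_estimate:
  fixes f :: "complex \<Rightarrow> 'b::real_normed_vector"
  defines "dir \<equiv> \<lambda>i::2. if i = 1 then 1 else \<i>"
  assumes S: "open S" "z \<in> S" and f: "\<And>w. w \<in> S \<Longrightarrow> f differentiable (at w)"
    and f2: "pd i f differentiable (at z)" and e: "e > 0"
  shows "\<exists>d>0. \<forall>h. 0 < h \<and> h < d \<longrightarrow>
    norm (f (z + h *\<^sub>R dir i + h *\<^sub>R dir j) - f (z + h *\<^sub>R dir i) - f (z + h *\<^sub>R dir j) + f z
          - h\<^sup>2 *\<^sub>R pd j (pd i f) z) \<le> e * h\<^sup>2"
proof -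
  define u v where "u = dir i" and "v = dir j"
  have uv: "norm u = 1" "norm v = 1"
    by (simp_all add: u_def v_def dir_def)
  let ?D = "frechet_derivative (pd i f) (at z)"
  have D: "(pd i f has_derivative ?D) (at z)"
    using f2 frechet_derivative_works by blast
  interpret D: linear ?D
    using f2 by (rule linear_frechet_derivative)
  obtain d1 where d1: "d1 > 0"
      "\<And>y. norm (y - z) < d1 \<Longrightarrow> norm (pd i f y - pd i f z - ?D (y - z)) \<le> e / 3 * norm (y - z)"
    using D e unfolding has_derivative_at_alt by (meson divide_pos_pos zero_less_numeral)
  obtain d2 where d2: "d2 > 0" "ball z d2 \<subseteq> S"
    using S open_contains_ball by blast
  (* The far corner of the square lies at distance at most 2 h from z. *)
  define d where "d = min d1 d2 / 2"
  have d: "d > 0"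
    using d1 d2 by (simp add: d_def)
  have main: "norm (f (z + h *\<^sub>R u + h *\<^sub>R v) - f (z + h *\<^sub>R u) - f (z + h *\<^sub>R v) + f z
      - h\<^sup>2 *\<^sub>R ?D v) \<le> e * h\<^sup>2" if h: "0 < h" "h < d" for h
  proof -
    (* The linear term is subtracted in advance, so that the derivative of g is small. *)
    define g where "g t = f (z + t *\<^sub>R u + h *\<^sub>R v) - f (z + t *\<^sub>R u) - (t * h) *\<^sub>R ?D v" for t
    have near: "norm (t *\<^sub>R u + h *\<^sub>R v) \<le> 2 * h" "norm (t *\<^sub>R u) \<le> h"
      if "t \<in> {0..h}" for t
      using that h norm_triangle_ineq[of "t *\<^sub>R u" "h *\<^sub>R v"] by (simp_all add: uv)
    have small: "2 * h < d1" "2 * h < d2"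
      using h by (simp_all add: d_def)
    have inS: "z + t *\<^sub>R u + h *\<^sub>R v \<in> S" "z + t *\<^sub>R u \<in> S" if "t \<in> {0..h}" for t
    proof -
      have "z + y \<in> S" if "norm y < d2" for y
        using d2 that by (auto simp: dist_norm subset_iff)
      from this[of "t *\<^sub>R u + h *\<^sub>R v"] this[of "t *\<^sub>R u"]
      show "z + t *\<^sub>R u + h *\<^sub>R v \<in> S" "z + t *\<^sub>R u \<in> S"
        using near[OF that] small h by (simp_all add: add.assoc)
    qed
    define g' where "g' t = pd i f (z + t *\<^sub>R u + h *\<^sub>R v) - pd i f (z + t *\<^sub>R u) - h *\<^sub>R ?D v" for t
    have g': "(g has_derivative (\<lambda>s. s *\<^sub>R g' t)) (at t within {0..h})" if t: "t \<in> {0..h}" for t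
    proof -
      have lin: "frechet_derivative f (at w) (s *\<^sub>R u) = s *\<^sub>R pd i f w" if "w \<in> S" for w s
        using linear_frechet_derivative[OF f[OF that]]
        by (simp add: linear_cmul pd_def u_def dir_def)
      have "((\<lambda>t. f (z + t *\<^sub>R u + h *\<^sub>R v)) has_derivative
          (\<lambda>s. frechet_derivative f (at (z + t *\<^sub>R u + h *\<^sub>R v)) (s *\<^sub>R u))) (at t within {0..h})"
        by (rule has_derivative_compose[of "\<lambda>t. z + t *\<^sub>R u + h *\<^sub>R v" "\<lambda>s. s *\<^sub>R u" t _ f])
          (auto intro!: derivative_eq_intros frechet_derivative_worksI f inS t)
      moreover have "((\<lambda>t. f (z + t *\<^sub>R u)) has_derivative
          (\<lambda>s. frechet_derivative f (at (z + t *\<^sub>R u)) (s *\<^sub>R u))) (at t within {0..h})"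
        by (rule has_derivative_compose[of "\<lambda>t. z + t *\<^sub>R u" "\<lambda>s. s *\<^sub>R u" t _ f])
          (auto intro!: derivative_eq_intros frechet_derivative_worksI f inS t)
      moreover have "((\<lambda>t. (t * h) *\<^sub>R ?D v) has_derivative (\<lambda>s. (s * h) *\<^sub>R ?D v)) (at t within {0..h})"
        by (auto intro!: derivative_eq_intros)
      ultimately have "(g has_derivative (\<lambda>s. s *\<^sub>R pd i f (z + t *\<^sub>R u + h *\<^sub>R v) - s *\<^sub>R pd i f (z + t *\<^sub>R u)
          - (s * h) *\<^sub>R ?D v)) (at t within {0..h})"
        unfolding g_def lin[OF inS(1)[OF t]] lin[OF inS(2)[OF t]] by (intro has_derivative_diff)
      then show ?thesis
        by (simp add: g'_def scaleR_diff_right)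
    qed
    have bound: "norm (g' t) \<le> e * h" if t: "t \<in> {0..h}" for t
    proof -
      let ?r = "\<lambda>y. pd i f (z + y) - pd i f z - ?D y"
      have r: "norm (?r y) \<le> e / 3 * norm y" if "norm y < d1" for y
        using d1(2)[of "z + y"] that by simp
      have "g' t = ?r (t *\<^sub>R u + h *\<^sub>R v) - ?r (t *\<^sub>R u)"
        by (simp add: g'_def D.add D.scaleR add.assoc)
      also have "norm \<dots> \<le> norm (?r (t *\<^sub>R u + h *\<^sub>R v)) + norm (?r (t *\<^sub>R u))"
        by (rule norm_triangle_ineq4)
      also have "\<dots> \<le> e / 3 * norm (t *\<^sub>R u + h *\<^sub>R v) + e / 3 * norm (t *\<^sub>R u)"
        using near[OF t] small h by (intro add_mono r) auto
      also have "\<dots> \<le> e / 3 * (2 * h) + e / 3 * h"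
        using near[OF t] e by (intro add_mono mult_left_mono) auto
      finally show ?thesis by simp
    qed
    have "norm (g h - g 0) \<le> e * h * norm (h - 0)"
    proof (rule differentiable_bound[of "{0..h}" g "\<lambda>t s. s *\<^sub>R g' t"])
      show "onorm (\<lambda>s. s *\<^sub>R g' t) \<le> e * h" if "t \<in> {0..h}" for t
        using bound[OF that] h e by (intro onorm_bound) (auto simp: mult.commute mult_left_mono)
    qed (use g' h in auto)
    also have "g h - g 0 = f (z + h *\<^sub>R u + h *\<^sub>R v) - f (z + h *\<^sub>R u) - f (z + h *\<^sub>R v) + f z - h\<^sup>2 *\<^sub>R ?D v"
      by (simp add: g_def power2_eq_square)
    finally show ?thesis
      using h by (simp add: power2_eq_square)
  qed
  have "pd j (pd i f) z = ?D v"
    by (simp add: pd_def[of j] v_def dir_def)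
  then show ?thesis
    using main d unfolding u_def[symmetric] v_def[symmetric] by auto
qed

text \<open>
  The second difference is symmetric in the two directions, so both mixed derivatives are its limit after
  division by \<open>h\<^sup>2\<close>.
\<close>

lemma pd_commute:
  fixes f :: "complex \<Rightarrow> 'b::real_normed_vector"
  assumes S: "open S" "z \<in> S" and f: "\<And>w. w \<in> S \<Longrightarrow> f differentiable (at w)"
    and f2: "\<And>i. pd i f differentiable (at z)"
  shows "pd i (pd j f) z = pd j (pd i f) z"
proof -
  define u v :: complex where "u = (if i = 1 then 1 else \<i>)" and "v = (if j = 1 then 1 else \<i>)"
  let ?X = "norm (pd i (pd j f) z - pd j (pd i f) z)"
  have "?X \<le> 2 * e" if e: "e > 0" for e
  proof -
    obtain d1 where d1: "d1 > 0" "\<And>h. 0 < h \<Longrightarrow> h < d1 \<Longrightarrow>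
       norm (f (z + h *\<^sub>R u + h *\<^sub>R v) - f (z + h *\<^sub>R u) - f (z + h *\<^sub>R v) + f z
          - h\<^sup>2 *\<^sub>R pd j (pd i f) z) \<le> e * h\<^sup>2"
      using second_difference_estimate[OF S f f2 e, of i j] unfolding u_def v_def by blast
    obtain d2 where d2: "d2 > 0" "\<And>h. 0 < h \<Longrightarrow> h < d2 \<Longrightarrow>
       norm (f (z + h *\<^sub>R v + h *\<^sub>R u) - f (z + h *\<^sub>R v) - f (z + h *\<^sub>R u) + f z
          - h\<^sup>2 *\<^sub>R pd i (pd j f) z) \<le> e * h\<^sup>2"
      using second_difference_estimate[OF S f f2 e, of j i] unfolding u_def v_def by blast
    define h where "h = min d1 d2 / 2"
    have h: "0 < h" "h < d1" "h < d2"
      using d1(1) d2(1) by (simp_all add: h_def)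
    let ?U = "f (z + h *\<^sub>R u + h *\<^sub>R v) - f (z + h *\<^sub>R u) - f (z + h *\<^sub>R v) + f z"
    have U: "f (z + h *\<^sub>R v + h *\<^sub>R u) - f (z + h *\<^sub>R v) - f (z + h *\<^sub>R u) + f z = ?U"
      by (simp add: algebra_simps)
    have "norm (?U - h\<^sup>2 *\<^sub>R pd j (pd i f) z) \<le> e * h\<^sup>2" "norm (?U - h\<^sup>2 *\<^sub>R pd i (pd j f) z) \<le> e * h\<^sup>2"
      using d1(2)[of h] d2(2)[of h, unfolded U] h by blast+
    then have "norm ((?U - h\<^sup>2 *\<^sub>R pd j (pd i f) z) - (?U - h\<^sup>2 *\<^sub>R pd i (pd j f) z)) \<le> e * h\<^sup>2 + e * h\<^sup>2"
      by (meson add_mono norm_triangle_ineq4 order_trans)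
    also have "(?U - h\<^sup>2 *\<^sub>R pd j (pd i f) z) - (?U - h\<^sup>2 *\<^sub>R pd i (pd j f) z)
        = h\<^sup>2 *\<^sub>R (pd i (pd j f) z - pd j (pd i f) z)"
      by (simp add: scaleR_diff_right)
    finally have "h\<^sup>2 * ?X \<le> h\<^sup>2 * (2 * e)"
      by (simp add: mult.commute)
    then show ?thesis
      using h by simp
  qed
  from this[of "?X / 4"] show ?thesis
    by (cases "?X = 0") auto
qed

section \<open>Normal parts and mean curvature\<close>

lemma normal_part_eqI:
  assumes "w - n \<in> span S" "\<And>s. s \<in> S \<Longrightarrow> n \<bullet> s = 0"
  shows "normal_part S w = n"
  unfolding normal_part_def
proof (rule the_equality)
  fix m assume m: "w - m \<in> span S \<and> (\<forall>s\<in>S. m \<bullet> s = 0)"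
  have "(w - n) - (w - m) \<in> span S"
    by (rule span_diff[OF assms(1) conjunct1[OF m]])
  also have "(w - n) - (w - m) = m - n"
    by (simp add: algebra_simps)
  finally have mn: "m - n \<in> span S" .
  have "orthogonal (m - n) (m - n)"
    by (rule orthogonal_to_span[OF mn])
      (use assms(2) conjunct2[OF m] in \<open>simp add: orthogonal_def inner_diff_left\<close>)
  then show "m = n"
    by (simp add: orthogonal_self)
qed (use assms in simp)

lemma
  shows normal_part_in_span: "w - normal_part S w \<in> span S"
    and normal_part_orthogonal: "s \<in> S \<Longrightarrow> normal_part S w \<bullet> s = 0"
proof -
  obtain y n where y: "y \<in> span S" and n: "\<And>s. s \<in> span S \<Longrightarrow> orthogonal n s" and w: "w = y + n"
    using orthogonal_subspace_decomp_exists[of S w] by metis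
  have "normal_part S w = n"
    using y n by (intro normal_part_eqI) (simp_all add: w orthogonal_def span_base)
  then show "w - normal_part S w \<in> span S" "s \<in> S \<Longrightarrow> normal_part S w \<bullet> s = 0"
    using y n[of s] by (simp_all add: w orthogonal_def span_base)
qed

lemma normal_part_eq_0_iff: "normal_part S w = 0 \<longleftrightarrow> w \<in> span S"
  using normal_part_in_span[of w S] normal_part_eqI[of w 0 S] by auto

lemma normal_part_add: "normal_part S (w + w') = normal_part S w + normal_part S w'"
proof (rule normal_part_eqI)
  have "(w - normal_part S w) + (w' - normal_part S w') \<in> span S"
    by (intro span_add normal_part_in_span)
  then show "w + w' - (normal_part S w + normal_part S w') \<in> span S"
    by (simp add: algebra_simps)
qed (simp add: inner_add_left normal_part_orthogonal)

lemma normal_part_id: "(\<And>s. s \<in> S \<Longrightarrow> w \<bullet> s = 0) \<Longrightarrow> normal_part S w = w"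
  by (intro normal_part_eqI) (simp_all add: span_zero)

lemma matrix_inv_scalar:
  fixes c :: real
  assumes "c \<noteq> 0"
  shows "matrix_inv (mat c :: real ^ 2 ^ 2) = mat (1 / c)"
proof -
  have mult: "mat c ** B = c *\<^sub>R B" "B ** mat c = c *\<^sub>R B" for B :: "real ^ 2 ^ 2" and c
    by (simp_all add: matrix_matrix_mult_def mat_def vec_eq_iff forall_2 sum_2)
  have "c *\<^sub>R mat (1 / c) = (mat 1 :: real ^ 2 ^ 2)"
    using assms by (simp add: mat_def vec_eq_iff)
  then have "\<exists>B. mat c ** B = (mat 1 :: real ^ 2 ^ 2) \<and> B ** mat c = mat 1"
    unfolding mult by blast
  then have "mat c ** matrix_inv (mat c :: real ^ 2 ^ 2) = mat 1"
    unfolding matrix_inv_def by (rule someI2_ex) simp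
  then have "(1 / c) *\<^sub>R (c *\<^sub>R matrix_inv (mat c :: real ^ 2 ^ 2)) = (1 / c) *\<^sub>R mat 1"
    by (simp only: mult)
  then have "matrix_inv (mat c :: real ^ 2 ^ 2) = (1 / c) *\<^sub>R mat 1"
    using assms by simp
  then show ?thesis
    by (simp add: mat_def vec_eq_iff)
qed

text \<open>
  In a conformal parametrization the trace of the second fundamental form is the normal part of the
  Laplacian divided by the conformal factor. Here the Laplacian \<open>L\<close> is already normal.
\<close>

lemma mean_curvature_conformal:
  assumes "pd 1 g z \<bullet> pd 1 g z = E" "pd 2 g z \<bullet> pd 2 g z = E" "pd 1 g z \<bullet> pd 2 g z = 0" "E \<noteq> 0"
    and "L = pd 1 (pd 1 g) z + pd 2 (pd 2 g) z" "L \<bullet> pd 1 g z = 0" "L \<bullet> pd 2 g z = 0"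
  shows "mean_curvature g z = (1 / (2 * E)) *\<^sub>R L"
proof -
  have "first_ff g z = mat E"
    using assms by (simp add: first_ff_def mat_def vec_eq_iff forall_2 inner_commute)
  then have "matrix_inv (first_ff g z) = mat (1 / E)"
    by (simp only: matrix_inv_scalar[OF \<open>E \<noteq> 0\<close>])
  then have "mean_curvature g z = (1 / (2 * E)) *\<^sub>R (second_ff g z 1 1 + second_ff g z 2 2)"
    by (simp add: mean_curvature_def sum_2 mat_def scaleR_add_right)
  also have "second_ff g z 1 1 + second_ff g z 2 2 = normal_part (tangent_basis g z) L"
    using assms by (simp add: second_ff_def normal_part_add)
  also have "\<dots> = L"
    using assms by (intro normal_part_id) (auto simp: tangent_basis_def)
  finally show ?thesis .
qed

section \<open>Totally real minimal surfaces in a coordinate\<close>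

definition conf :: "(complex \<Rightarrow> real ^ 7) \<Rightarrow> complex \<Rightarrow> real" where
  "conf f z = pd 1 f z \<bullet> pd 1 f z"

definition unit_normal :: "(complex \<Rightarrow> real ^ 7) \<Rightarrow> complex \<Rightarrow> real ^ 7" where
  "unit_normal f z = (1 / conf f z) *\<^sub>R cross7 (pd 1 f z) (pd 2 f z)"

text \<open>
  The seventh vector of the frame generated by \<open>f, f\<^sub>x, f\<^sub>y\<close>. It is normal to the surface in the sphere and to
  the other six frame vectors; when it is constant, it is the axis of the rotation in the classification.
\<close>

definition frame_axis :: "(complex \<Rightarrow> real ^ 7) \<Rightarrow> complex \<Rightarrow> real ^ 7" where
  "frame_axis f z = cross7 (f z) (unit_normal f z)"

text \<open>
  A totally real minimal immersion into the unit sphere, read in a chart with image \<open>S\<close>. Outside \<open>S\<close> the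
  function \<open>f\<close> is arbitrary. Minimality is stated as \<open>\<Delta>f = - 2 |f\<^sub>x|\<^sup>2 f\<close>, which includes the multiple of \<open>f\<close>
  forced by \<open>f \<bullet> f = 1\<close>.
\<close>

locale totally_real_minimal_chart =
  fixes S :: "complex set" and f :: "complex \<Rightarrow> real ^ 7"
  assumes open_S: "open S"
    and smooth: "Ck_on k S f"
    and unit: "z \<in> S \<Longrightarrow> f z \<bullet> f z = 1"
    and conformal: "z \<in> S \<Longrightarrow> pd 1 f z \<bullet> pd 2 f z = 0"
      "z \<in> S \<Longrightarrow> pd 2 f z \<bullet> pd 2 f z = pd 1 f z \<bullet> pd 1 f z"
    and immersed: "z \<in> S \<Longrightarrow> pd 1 f z \<noteq> 0"
    and totally_real: "z \<in> S \<Longrightarrow> f z \<bullet> cross7 (pd 1 f z) (pd 2 f z) = 0"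
    and harmonic: "z \<in> S \<Longrightarrow> pd 1 (pd 1 f) z + pd 2 (pd 2 f) z = - (2 * conf f z) *\<^sub>R f z"
begin

lemma differentiable:
  assumes "z \<in> S"
  shows "f differentiable (at z)" "pd i f differentiable (at z)" "pd i (pd j f) differentiable (at z)"
  using smooth[of "Suc (Suc (Suc 0))"] assms by auto

lemma commute: "z \<in> S \<Longrightarrow> pd 2 (pd 1 f) z = pd 1 (pd 2 f) z"
  by (rule pd_commute[OF open_S]) (auto simp: differentiable)

lemma conf_pos: "z \<in> S \<Longrightarrow> conf f z > 0"
  using immersed by (simp add: conf_def)

lemma frame:
  assumes z: "z \<in> S"
  shows "g2_frame (f z) (pd 1 f z) (pd 2 f z) (conf f z)"
proof
  have "f z \<bullet> pd i f z = 0" for i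
  proof -
    have "pd i f z \<bullet> f z + f z \<bullet> pd i f z = 0"
      unfolding pd_inner[OF differentiable(1)[OF z] differentiable(1)[OF z], symmetric]
      using unit by (intro pd_eq_0_open[OF open_S z])
    then show ?thesis
      by (simp add: inner_commute)
  qed
  then show "f z \<bullet> pd 1 f z = 0" "f z \<bullet> pd 2 f z = 0"
    by blast+
qed (use z unit conformal conf_pos totally_real in \<open>auto simp: conf_def\<close>)

lemma cross_eq: "z \<in> S \<Longrightarrow> cross7 (pd 1 f z) (pd 2 f z) = conf f z *\<^sub>R unit_normal f z"
  using conf_pos[of z] by (simp add: unit_normal_def)

lemma differentiable_conf:
  assumes z: "z \<in> S"
  shows "conf f differentiable (at z)"
proof -
  have "(\<lambda>w. pd 1 f w \<bullet> pd 1 f w) differentiable (at z)"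
    using bounded_bilinear.differentiable_prod[OF bounded_bilinear_inner] differentiable z by blast
  then show ?thesis
    by (simp add: conf_def[abs_def])
qed

lemma differentiable_unit_normal:
  assumes z: "z \<in> S"
  shows "unit_normal f differentiable (at z)"
proof -
  have "(\<lambda>w. 1 / conf f w) differentiable (at z)"
    using differentiable_conf[OF z] conf_pos[OF z] by (intro differentiable_divide) auto
  moreover have "(\<lambda>w. cross7 (pd 1 f w) (pd 2 f w)) differentiable (at z)"
    using differentiable[OF z] by (intro cross7.differentiable_prod)
  ultimately show ?thesis
    unfolding unit_normal_def[abs_def] by (rule bounded_bilinear.differentiable_prod[OF bounded_bilinear_scaleR])
qed

lemma differentiable_frame_axis:
  "z \<in> S \<Longrightarrow> frame_axis f differentiable (at z)"
  unfolding frame_axis_def[abs_def]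
  by (intro cross7.differentiable_prod differentiable differentiable_unit_normal)

lemma unit_normal:
  assumes z: "z \<in> S"
  shows "unit_normal f z \<bullet> f z = 0" "unit_normal f z \<bullet> unit_normal f z = 1"
    "unit_normal f z \<bullet> pd 1 f z = 0" "unit_normal f z \<bullet> pd 2 f z = 0"
    "unit_normal f z \<bullet> cross7 (f z) (pd i f z) = 0"
    "cross7 (pd 1 f z) (unit_normal f z) = - pd 2 f z"
    "cross7 (pd 2 f z) (unit_normal f z) = pd 1 f z"
proof -
  interpret g2_frame "f z" "pd 1 f z" "pd 2 f z" "conf f z"
    by (rule frame[OF z])
  show "unit_normal f z \<bullet> cross7 (f z) (pd i f z) = 0"
    using exhaust_2[of i] by (auto simp: unit_normal_def inner_products_commuted)
  show "unit_normal f z \<bullet> unit_normal f z = 1"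
    using w_pos by (simp add: unit_normal_def inner_products power2_eq_square)
qed (use conf_pos[OF z] frame[OF z] in \<open>auto simp: unit_normal_def cross7.scaleR_right g2_frame.double_cross g2_frame.inner_triple\<close>)

lemma pd_unit_normal_orthogonal:
  assumes z: "z \<in> S"
  shows "pd i (unit_normal f) z \<bullet> f z = 0" "pd i (unit_normal f) z \<bullet> unit_normal f z = 0"
proof -
  have "pd i (unit_normal f) z \<bullet> f z + unit_normal f z \<bullet> pd i f z = 0"
    unfolding pd_inner[OF differentiable_unit_normal[OF z] differentiable(1)[OF z], symmetric]
    using unit_normal by (intro pd_eq_0_open[OF open_S z])
  then show "pd i (unit_normal f) z \<bullet> f z = 0"
    using exhaust_2[of i] unit_normal[OF z] by auto
  have "pd i (unit_normal f) z \<bullet> unit_normal f z + unit_normal f z \<bullet> pd i (unit_normal f) z = 0"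
    unfolding pd_inner[OF differentiable_unit_normal[OF z] differentiable_unit_normal[OF z], symmetric]
    using unit_normal by (intro pd_eq_0_open[OF open_S z])
  then show "pd i (unit_normal f) z \<bullet> unit_normal f z = 0"
    by (simp add: inner_commute)
qed

lemma pd_frame_axis:
  "z \<in> S \<Longrightarrow> pd i (frame_axis f) z = cross7 (pd i f z) (unit_normal f z) + cross7 (f z) (pd i (unit_normal f) z)"
  unfolding frame_axis_def[abs_def] by (simp add: pd_cross7 differentiable differentiable_unit_normal)

text \<open>
  In terms of a primitive \<open>F\<close> with \<open>F\<^sub>x = f \<times> f\<^sub>y\<close> and \<open>F\<^sub>y = - f \<times> f\<^sub>x\<close> this is \<open>d(N + F) = 0\<close> at \<open>z\<close>; the
  formulation refers to \<open>f\<close> alone.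
\<close>

definition normal_plus_primitive_stationary :: "complex \<Rightarrow> bool" where
  "normal_plus_primitive_stationary z \<longleftrightarrow> pd 1 (unit_normal f) z = - cross7 (f z) (pd 2 f z)
     \<and> pd 2 (unit_normal f) z = cross7 (f z) (pd 1 f z)"

text \<open>
  The derivatives of \<open>V = f \<times> N\<close> are \<open>- f\<^sub>y + f \<times> N\<^sub>x\<close> and \<open>f\<^sub>x + f \<times> N\<^sub>y\<close>, and multiplication by \<open>f\<close> is
  invertible on the complement of \<open>f\<close>, to which \<open>N\<^sub>x\<close> and \<open>N\<^sub>y\<close> belong.
\<close>

lemma frame_axis_stationary_iff:
  assumes z: "z \<in> S"
  shows "(\<forall>i. pd i (frame_axis f) z = 0) \<longleftrightarrow> normal_plus_primitive_stationary z"
proof -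
  interpret g2_frame "f z" "pd 1 f z" "pd 2 f z" "conf f z"
    by (rule frame[OF z])
  have solve: "cross7 (f z) u = y \<longleftrightarrow> u = - cross7 (f z) y" if "u \<bullet> f z = 0" "y \<bullet> f z = 0" for u y
    using that cross7_cross7_same[of "f z" u] cross7_cross7_same[of "f z" y]
    by (auto simp: ff inner_commute cross7.minus_right)
  have "pd 1 (frame_axis f) z = 0 \<longleftrightarrow> cross7 (f z) (pd 1 (unit_normal f) z) = pd 2 f z"
    by (simp add: pd_frame_axis[OF z] unit_normal[OF z])
  moreover have "pd 2 (frame_axis f) z = 0 \<longleftrightarrow> cross7 (f z) (pd 2 (unit_normal f) z) = - pd 1 f z"
    by (simp add: pd_frame_axis[OF z] unit_normal[OF z] eq_neg_iff_add_eq_0 add.commute)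
  ultimately show ?thesis
    using pd_unit_normal_orthogonal[OF z]
    by (simp add: forall_2 normal_plus_primitive_stationary_def solve swapped cross7.minus_right)
qed

end

section \<open>The surfaces \<open>F + \<phi>\<close> and \<open>F - \<phi>\<close>\<close>

locale totally_real_primitive = totally_real_minimal_chart +
  fixes G :: "complex \<Rightarrow> real ^ 7"
  assumes differentiable_G: "z \<in> S \<Longrightarrow> G differentiable (at z)"
    and pd_G: "z \<in> S \<Longrightarrow> pd 1 G z = cross7 (f z) (pd 2 f z)"
      "z \<in> S \<Longrightarrow> pd 2 G z = - cross7 (f z) (pd 1 f z)"
begin

lemma smooth_G: "Ck_on k S G"
proof (cases k)
  case 0
  then show ?thesis
    using differentiable_G
    by (auto intro!: continuous_at_imp_continuous_on differentiable_imp_continuous_within)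
next
  case (Suc k')
  have f: "Ck_on k' S f" "Ck_on k' S (pd i f)" for i
    using smooth[of "Suc k'"] smooth[of k'] by auto
  have "Ck_on k' S (pd 1 G) \<longleftrightarrow> Ck_on k' S (\<lambda>z. cross7 (f z) (pd 2 f z))"
    by (intro Ck_on_cong open_S pd_G)
  moreover have "Ck_on k' S (pd 2 G) \<longleftrightarrow> Ck_on k' S (\<lambda>z. - cross7 (f z) (pd 1 f z))"
    by (intro Ck_on_cong open_S pd_G)
  moreover have "Ck_on k' S (\<lambda>z. cross7 (f z) (pd i f z))" for i
    by (intro cross7.Ck_on_prod open_S f)
  moreover from this have "Ck_on k' S (\<lambda>z. - cross7 (f z) (pd i f z))" for i
    by (intro bounded_linear.Ck_on_linear[OF bounded_linear_minus[OF bounded_linear_ident]] open_S)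
  ultimately show ?thesis
    using differentiable_G by (simp add: Suc forall_2)
qed

text \<open>
  The sign \<open>\<sigma>\<close> treats \<open>F + \<phi>\<close> and \<open>F - \<phi>\<close> at once.
\<close>

context
  fixes \<sigma> :: real
  assumes sigma: "\<sigma> = 1 \<or> \<sigma> = - 1"
begin

abbreviation (input) "H \<equiv> \<lambda>z. G z + \<sigma> *\<^sub>R f z"

lemma smooth_H: "Ck_on k S H"
  by (intro Ck_on_add open_S smooth_G
      bounded_linear.Ck_on_linear[OF bounded_linear_scaleR_right] smooth)

lemma pd_H:
  assumes z: "z \<in> S"
  shows "pd 1 H z = cross7 (f z) (pd 2 f z) + \<sigma> *\<^sub>R pd 1 f z"
    "pd 2 H z = - cross7 (f z) (pd 1 f z) + \<sigma> *\<^sub>R pd 2 f z"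
  using differentiable_G[OF z] differentiable(1)[OF z]
  by (simp_all add: pd_add pd_scaleR_right differentiable_scaleR pd_G[OF z])

lemma H_conformal:
  assumes z: "z \<in> S"
  shows "pd 1 H z \<bullet> pd 1 H z = 2 * conf f z" "pd 2 H z \<bullet> pd 2 H z = 2 * conf f z"
    "pd 1 H z \<bullet> pd 2 H z = 0"
proof -
  interpret g2_frame "f z" "pd 1 f z" "pd 2 f z" "conf f z"
    by (rule frame[OF z])
  show "pd 1 H z \<bullet> pd 1 H z = 2 * conf f z" "pd 2 H z \<bullet> pd 2 H z = 2 * conf f z"
    "pd 1 H z \<bullet> pd 2 H z = 0"
    using sigma
    by (auto simp: pd_H[OF z] inner_simps basic inner_products inner_products_commuted)
qed

text \<open>
  The terms \<open>f \<times> f\<^sub>x\<^sub>y\<close> cancel by the symmetry of second derivatives, leaving \<open>2 f\<^sub>x \<times> f\<^sub>y\<close> from \<open>G\<close> and the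
  Laplacian of \<open>f\<close>, a multiple of \<open>f\<close>.
\<close>

lemma H_laplacian:
  assumes z: "z \<in> S"
  shows "pd 1 (pd 1 H) z + pd 2 (pd 2 H) z = (2 * conf f z) *\<^sub>R (unit_normal f z - \<sigma> *\<^sub>R f z)"
proof -
  note d = differentiable[OF z]
  have dc: "(\<lambda>z. cross7 (f z) (pd i f z)) differentiable (at z)" for i
    by (intro cross7.differentiable_prod d)
  have "pd 1 (pd 1 H) z = pd 1 (\<lambda>z. cross7 (f z) (pd 2 f z) + \<sigma> *\<^sub>R pd 1 f z) z"
    by (rule pd_cong_open[OF open_S z pd_H(1)])
  also have "\<dots> = cross7 (pd 1 f z) (pd 2 f z) + cross7 (f z) (pd 1 (pd 2 f) z) + \<sigma> *\<^sub>R pd 1 (pd 1 f) z"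
    by (simp add: pd_add pd_scaleR_right pd_cross7 d dc differentiable_scaleR)
  finally have 1: "pd 1 (pd 1 H) z = \<dots>" .
  have "pd 2 (pd 2 H) z = pd 2 (\<lambda>z. - cross7 (f z) (pd 1 f z) + \<sigma> *\<^sub>R pd 2 f z) z"
    by (rule pd_cong_open[OF open_S z pd_H(2)])
  also have "\<dots> = - (cross7 (pd 2 f z) (pd 1 f z) + cross7 (f z) (pd 2 (pd 1 f) z)) + \<sigma> *\<^sub>R pd 2 (pd 2 f) z"
    by (simp add: pd_diff pd_scaleR_right pd_cross7 d dc differentiable_scaleR)
  also have "\<dots> = cross7 (pd 1 f z) (pd 2 f z) - cross7 (f z) (pd 1 (pd 2 f) z) + \<sigma> *\<^sub>R pd 2 (pd 2 f) z"
    using cross7_skew[of "pd 2 f z" "pd 1 f z"] by (simp add: commute[OF z])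
  finally have "pd 1 (pd 1 H) z + pd 2 (pd 2 H) z
      = 2 *\<^sub>R cross7 (pd 1 f z) (pd 2 f z) + \<sigma> *\<^sub>R (pd 1 (pd 1 f) z + pd 2 (pd 2 f) z)"
    by (simp add: 1 scaleR_add_right scaleR_2)
  then show ?thesis
    by (simp add: harmonic[OF z] cross_eq[OF z] scaleR_diff_right)
qed

lemma mean_curvature_H:
  assumes z: "z \<in> S"
  shows "mean_curvature H z = (1/2) *\<^sub>R (unit_normal f z - \<sigma> *\<^sub>R f z)"
proof -
  interpret g2_frame "f z" "pd 1 f z" "pd 2 f z" "conf f z"
    by (rule frame[OF z])
  have "mean_curvature H z = (1 / (2 * (2 * conf f z))) *\<^sub>R ((2 * conf f z) *\<^sub>R (unit_normal f z - \<sigma> *\<^sub>R f z))"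
    using w_pos unit_normal[OF z]
    by (intro mean_curvature_conformal H_conformal[OF z] H_laplacian[OF z, symmetric])
      (simp_all add: pd_H[OF z] inner_simps basic)
  then show ?thesis
    using w_pos by simp
qed

lemma pd_mean_curvature_H:
  assumes z: "z \<in> S"
  shows "pd i (mean_curvature H) z = (1/2) *\<^sub>R (pd i (unit_normal f) z - \<sigma> *\<^sub>R pd i f z)"
proof -
  note d = differentiable_unit_normal[OF z] differentiable(1)[OF z]
  have "pd i (mean_curvature H) z = pd i (\<lambda>z. (1/2) *\<^sub>R (unit_normal f z + (- \<sigma>) *\<^sub>R f z)) z"
    using mean_curvature_H by (intro pd_cong_open[OF open_S z]) simp
  also have "\<dots> = (1/2) *\<^sub>R (pd i (unit_normal f) z + (- \<sigma>) *\<^sub>R pd i f z)"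
    using pd_add[OF d(1) differentiable_scaleR[OF differentiable_const d(2)], of i "- \<sigma>"]
    by (simp add: pd_scaleR_right d differentiable_scaleR differentiable_add
      del: scaleR_minus_left)
  finally show ?thesis by simp
qed

lemma parallel_H_iff:
  assumes z: "z \<in> S"
  shows "normal_part (tangent_basis H z) (pd i (mean_curvature H) z) = 0
    \<longleftrightarrow> pd i (unit_normal f) z - \<sigma> *\<^sub>R pd i f z \<in>
        span {cross7 (f z) (pd 2 f z) + \<sigma> *\<^sub>R pd 1 f z, - cross7 (f z) (pd 1 f z) + \<sigma> *\<^sub>R pd 2 f z}"
proof -
  have "(1/2) *\<^sub>R x \<in> span T \<longleftrightarrow> x \<in> span T" for x and T :: "(real ^ 7) set"
    using span_scale[of "(1/2) *\<^sub>R x" T 2] span_scale[of x T "1/2"] by auto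
  then show ?thesis
    by (simp only: normal_part_eq_0_iff tangent_basis_def pd_H[OF z] pd_mean_curvature_H[OF z])
qed

end

lemma H_immersion:
  assumes \<sigma>: "\<sigma> = 1 \<or> \<sigma> = - 1" and z: "z \<in> S"
  shows "inj (frechet_derivative (\<lambda>z. G z + \<sigma> *\<^sub>R f z) (at z))"
proof -
  let ?H = "\<lambda>z. G z + \<sigma> *\<^sub>R f z"
  have d: "?H differentiable (at z)"
    using differentiable_G[OF z] differentiable(1)[OF z] by (auto intro!: differentiable_add differentiable_scaleR)
  have "h = 0" if "frechet_derivative ?H (at z) h = 0" for h
  proof -
    have "frechet_derivative ?H (at z) h \<bullet> frechet_derivative ?H (at z) h
        = Re h * Re h * (2 * conf f z) + Im h * Im h * (2 * conf f z)"
      using H_conformal[OF \<sigma> z]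
      by (simp add: frechet_derivative_pd[OF d] inner_add_left inner_add_right inner_commute[of "pd 2 ?H z" "pd 1 ?H z"])
    then have "(Re h * Re h + Im h * Im h) * (2 * conf f z) = 0"
      using that by (simp add: distrib_right)
    then show "h = 0"
      using conf_pos[OF z] by (simp add: complex_eq_iff sum_squares_eq_zero_iff)
  qed
  then show ?thesis
    using linear_injective_0[OF linear_frechet_derivative[OF d]] by blast
qed

text \<open>
  The derivatives of the mean curvature vectors are \<open>(N\<^sub>i \<mp> f\<^sub>i) / 2\<close>. Each surface separately allows a plane of
  values for \<open>N\<^sub>i\<close>; both together leave only the values with \<open>dN = - dF\<close>.
\<close>

lemma parallel_both_iff:
  assumes z: "z \<in> S"
  shows "(\<forall>i. normal_part (tangent_basis (\<lambda>z. G z + 1 *\<^sub>R f z) z) (pd i (mean_curvature (\<lambda>z. G z + 1 *\<^sub>R f z)) z) = 0)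
       \<and> (\<forall>i. normal_part (tangent_basis (\<lambda>z. G z + (- 1) *\<^sub>R f z) z) (pd i (mean_curvature (\<lambda>z. G z + (- 1) *\<^sub>R f z)) z) = 0)
    \<longleftrightarrow> (\<forall>i. pd i (frame_axis f) z = 0)"
proof -
  interpret g2_frame "f z" "pd 1 f z" "pd 2 f z" "conf f z"
    by (rule frame[OF z])
  show ?thesis
    unfolding frame_axis_stationary_iff[OF z] normal_plus_primitive_stationary_def
      opposite_spans_iff(1)[symmetric] opposite_spans_iff(2)[symmetric]
      parallel_H_iff[OF disjI1[OF refl] z] parallel_H_iff[OF disjI2[OF refl] z] forall_2
    by auto
qed

end

section \<open>Surfaces with stationary axis\<close>

context totally_real_minimal_chart
begin

lemma pd_inner_const:
  assumes z: "z \<in> S" and d: "g differentiable (at z)" "h differentiable (at z)"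
    and const: "\<And>z. z \<in> S \<Longrightarrow> g z \<bullet> h z = c"
  shows "pd i g z \<bullet> h z = - (g z \<bullet> pd i h z)"
proof -
  have "pd i g z \<bullet> h z + g z \<bullet> pd i h z = 0"
    unfolding pd_inner[OF d, symmetric] using const by (intro pd_eq_0_open[OF open_S z])
  then show ?thesis
    by simp
qed

lemma inner_pd:
  assumes z: "z \<in> S"
  shows "f z \<bullet> pd i f z = 0"
  using exhaust_2[of i] g2_frame.fa[OF frame[OF z]] g2_frame.fb[OF frame[OF z]] by auto

lemma inner_pd_pd:
  assumes z: "z \<in> S"
  shows "pd j (pd i f) z \<bullet> f z = - (pd i f z \<bullet> pd j f z)"
  using pd_inner_const[OF z differentiable(2,1)[OF z], of i 0 j] inner_pd by (simp add: inner_commute)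

text \<open>
  If every second derivative of \<open>f\<close> lies in the span of \<open>f, f\<^sub>x, f\<^sub>y\<close>, differentiating
  \<open>|f\<^sub>x|\<^sup>2 N = f\<^sub>x \<times> f\<^sub>y\<close> produces only multiples of \<open>N\<close> and of \<open>f \<times> f\<^sub>x, f \<times> f\<^sub>y\<close>. The multiple of \<open>N\<close>
  is absorbed by the derivative of the factor, as \<open>N\<close> has unit length, and the other coefficients are
  \<open>f \<bullet> f\<^sub>i\<^sub>j = - f\<^sub>i \<bullet> f\<^sub>j\<close>.
\<close>

lemma totally_geodesic_imp_stationary:
  assumes z: "z \<in> S" and tg: "\<And>i j. sphere_second_ff f z i j = 0"
  shows "pd i (frame_axis f) z = 0"
proof -
  interpret g2_frame "f z" "pd 1 f z" "pd 2 f z" "conf f z"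
    by (rule frame[OF z])
  let ?a = "pd 1 f z" and ?b = "pd 2 f z" and ?N = "unit_normal f z" and ?w = "conf f z"
  have coeff: "\<exists>k l. pd i (pd j f) z = - (pd i f z \<bullet> pd j f z) *\<^sub>R f z + k *\<^sub>R ?a + l *\<^sub>R ?b" for i j
  proof -
    have "pd i (pd j f) z \<in> span (insert (f z) {?a, ?b})"
      using tg[of i j] by (simp add: sphere_second_ff_def normal_part_eq_0_iff tangent_basis_def)
    then obtain c where "pd i (pd j f) z - c *\<^sub>R f z \<in> span {?a, ?b}"
      unfolding span_breakdown_eq[of _ "f z"] by blast
    then obtain k l where "pd i (pd j f) z - c *\<^sub>R f z = k *\<^sub>R ?a + l *\<^sub>R ?b"
      using span_pair by blast
    then have eq: "pd i (pd j f) z = c *\<^sub>R f z + k *\<^sub>R ?a + l *\<^sub>R ?b"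
      by (simp add: algebra_simps)
    then have "pd i (pd j f) z \<bullet> f z = c"
      by (simp add: inner_simps basic)
    then show ?thesis
      using eq inner_pd_pd[OF z, of i j] by (auto simp: inner_commute)
  qed
  have deriv: "cross7 (pd i (pd 1 f) z) ?b + cross7 ?a (pd i (pd 2 f) z)
      = ?w *\<^sub>R pd i (unit_normal f) z + pd i (conf f) z *\<^sub>R ?N" for i
  proof -
    have "pd i (\<lambda>z. cross7 (pd 1 f z) (pd 2 f z)) z = pd i (\<lambda>z. conf f z *\<^sub>R unit_normal f z) z"
      by (intro pd_cong_open[OF open_S z] cross_eq)
    then show ?thesis
      by (simp add: pd_cross7 pd_scaleR differentiable[OF z] differentiable_conf[OF z]
          differentiable_unit_normal[OF z] add.commute)
  qed
  have antidual: "pd i (unit_normal f) z = y"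
    if e: "cross7 (pd i (pd 1 f) z) ?b + cross7 ?a (pd i (pd 2 f) z) = ?w *\<^sub>R y + c *\<^sub>R ?N"
      and y: "y \<bullet> ?N = 0" for i y c
  proof -
    have "(?w *\<^sub>R pd i (unit_normal f) z + pd i (conf f) z *\<^sub>R ?N) \<bullet> ?N = (?w *\<^sub>R y + c *\<^sub>R ?N) \<bullet> ?N"
      using deriv e by simp
    then have "pd i (conf f) z = c"
      using y by (simp add: inner_simps pd_unit_normal_orthogonal[OF z] unit_normal[OF z])
    then have "?w *\<^sub>R pd i (unit_normal f) z = ?w *\<^sub>R y"
      using deriv[of i] e by auto
    then show ?thesis
      using w_pos by simp
  qed
  note simps = cross7.diff_left cross7.diff_right cross7.add_left cross7.add_right cross7.scaleR_left cross7.scaleR_right basic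
    cross_eq[OF z] cross7_skew[of ?a "f z"] cross7.minus_left cross7.minus_right
  obtain k1 l1 where 1: "pd 1 (pd 1 f) z = - ?w *\<^sub>R f z + k1 *\<^sub>R ?a + l1 *\<^sub>R ?b"
    using coeff[of 1 1] unfolding aa by blast
  obtain k2 l2 where 2: "pd 1 (pd 2 f) z = k2 *\<^sub>R ?a + l2 *\<^sub>R ?b"
    using coeff[of 1 2] by (auto simp: basic)
  obtain k3 l3 where 3: "pd 2 (pd 2 f) z = - ?w *\<^sub>R f z + k3 *\<^sub>R ?a + l3 *\<^sub>R ?b"
    using coeff[of 2 2] unfolding bb by blast
  have "pd 1 (unit_normal f) z = - cross7 (f z) ?b"
    by (rule antidual[of 1 _ "(k1 + l2) * ?w"])
      (simp_all add: 1 2 simps unit_normal[OF z] inner_commute[of _ ?N] distrib_right scaleR_add_left)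
  moreover have "pd 2 (unit_normal f) z = cross7 (f z) ?a"
    by (rule antidual[of 2 _ "(k2 + l3) * ?w"])
      (simp_all add: 2 3 simps commute[OF z] unit_normal[OF z] inner_commute[of _ ?N] distrib_right scaleR_add_left)
  ultimately have "normal_plus_primitive_stationary z"
    by (simp add: normal_plus_primitive_stationary_def)
  then show ?thesis
    using frame_axis_stationary_iff[OF z] by blast
qed

lemma frame_axis:
  assumes z: "z \<in> S"
  shows "frame_axis f z \<bullet> f z = 0" "frame_axis f z \<bullet> pd i f z = 0"
    "frame_axis f z \<bullet> cross7 (f z) (pd i f z) = 0"
    "frame_axis f z \<bullet> frame_axis f z = 1" "conf f z *\<^sub>R frame_axis f z = cross7 (f z) (cross7 (pd 1 f z) (pd 2 f z))"
    "cross7 (frame_axis f z) (cross7 (f z) (pd 1 f z)) = - pd 2 f z"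
proof -
  interpret g2_frame "f z" "pd 1 f z" "pd 2 f z" "conf f z"
    by (rule frame[OF z])
  have V: "frame_axis f z = (1 / conf f z) *\<^sub>R cross7 (f z) (cross7 (pd 1 f z) (pd 2 f z))"
    by (simp add: frame_axis_def unit_normal_def cross7.scaleR_right)
  show "frame_axis f z \<bullet> pd i f z = 0" "frame_axis f z \<bullet> cross7 (f z) (pd i f z) = 0"
    using exhaust_2[of i] by (auto simp: V inner_products)
  show "frame_axis f z \<bullet> f z = 0" "frame_axis f z \<bullet> frame_axis f z = 1" "conf f z *\<^sub>R frame_axis f z = cross7 (f z) (cross7 (pd 1 f z) (pd 2 f z))"
    "cross7 (frame_axis f z) (cross7 (f z) (pd 1 f z)) = - pd 2 f z"
    using w_pos by (simp_all add: V inner_products power2_eq_square cross7.scaleR_left axis_cross_fa)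
qed

text \<open>
  Let \<open>n\<close> be orthogonal to the axis and to the surface, hence to all derivatives of \<open>f\<close>. Constancy of the axis
  confines the second fundamental form to the span of \<open>f \<times> f\<^sub>x, f \<times> f\<^sub>y\<close>, and since it is symmetric and traceless
  its components there are \<open>(A, B)\<close> for \<open>f\<^sub>x\<^sub>x\<close> and \<open>(B, - A)\<close> for \<open>f\<^sub>x\<^sub>y\<close>. Where \<open>A\<^sup>2 + B\<^sup>2 \<noteq> 0\<close> these
  determine \<open>f \<times> f\<^sub>x\<close> and \<open>f \<times> f\<^sub>y\<close>, so \<open>n\<close> is orthogonal to them on a neighbourhood of \<open>z0\<close>. One more
  derivative yields \<open>f\<^sub>x \<times> f\<^sub>y\<close>, and \<open>n\<close> is orthogonal to the whole frame.
\<close>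

lemma full_if_not_totally_geodesic:
  assumes axis: "\<And>z. z \<in> S \<Longrightarrow> frame_axis f z = v"
    and z0: "z0 \<in> S" and ntg: "sphere_second_ff f z0 i0 j0 \<noteq> 0"
    and nv: "n \<bullet> v = 0" and nf: "\<And>z. z \<in> S \<Longrightarrow> n \<bullet> f z = 0"
  shows "n = 0"
proof -
  define A where "A z = pd 1 (pd 1 f) z \<bullet> cross7 (f z) (pd 1 f z)" for z
  define B where "B z = pd 1 (pd 1 f) z \<bullet> cross7 (f z) (pd 2 f z)" for z
  define p where "p i z = n \<bullet> cross7 (f z) (pd i f z)" for i z
  note d = differentiable
  have dc: "(\<lambda>z. cross7 (f z) (pd i f z)) differentiable (at z)" if "z \<in> S" for z i
    using d[OF that] by (intro cross7.differentiable_prod)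
  have antidual: "normal_plus_primitive_stationary z" if z: "z \<in> S" for z
    using pd_eq_0_open[OF open_S z, of "frame_axis f" v] axis frame_axis_stationary_iff[OF z] by blast
  have dn: "n \<bullet> pd i g z = 0" if "z \<in> S" "g differentiable (at z)" "\<And>z. z \<in> S \<Longrightarrow> n \<bullet> g z = 0" for n g i z
    using pd_inner_const[of z "\<lambda>z. n" g 0 i] that by simp
  have nf1: "n \<bullet> pd i f z = 0" if "z \<in> S" for i z
    using dn[OF that d(1)[OF that] nf] .
  have nf2: "n \<bullet> pd j (pd i f) z = 0" if "z \<in> S" for i j z
    using dn[OF that d(2)[OF that] nf1] .
  have vf1: "v \<bullet> pd i f z = 0" if "z \<in> S" for i z
    using frame_axis(2)[OF that] axis[OF that] by simp
  have vf2: "v \<bullet> pd j (pd i f) z = 0" if "z \<in> S" for i j z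
    using dn[OF that d(2)[OF that] vf1] .
  have N1: "unit_normal f z \<bullet> pd i f z = 0" if "z \<in> S" for i z
    using exhaust_2[of i] unit_normal[OF that] by auto
  have N2: "unit_normal f z \<bullet> pd j (pd i f) z = 0" if z: "z \<in> S" for i j z
  proof -
    interpret g2_frame "f z" "pd 1 f z" "pd 2 f z" "conf f z"
      by (rule frame[OF z])
    have "pd j (unit_normal f) z \<bullet> pd i f z = 0"
      using antidual[OF z] exhaust_2[of i] exhaust_2[of j] by (auto simp: normal_plus_primitive_stationary_def)
    then show ?thesis
      using pd_inner_const[OF z differentiable_unit_normal[OF z] d(2)[OF z] N1, of j i] by simp
  qed
  have expand: "conf f z *\<^sub>R pd j (pd i f) z = (conf f z * (pd j (pd i f) z \<bullet> f z)) *\<^sub>R f z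
      + (pd j (pd i f) z \<bullet> pd 1 f z) *\<^sub>R pd 1 f z + (pd j (pd i f) z \<bullet> pd 2 f z) *\<^sub>R pd 2 f z
      + (pd j (pd i f) z \<bullet> cross7 (f z) (pd 1 f z)) *\<^sub>R cross7 (f z) (pd 1 f z)
      + (pd j (pd i f) z \<bullet> cross7 (f z) (pd 2 f z)) *\<^sub>R cross7 (f z) (pd 2 f z)" if z: "z \<in> S" for i j z
    using z vf2[OF z, of j i] N2[OF z, of j i] axis[OF z]
    by (intro g2_frame.decompose[OF frame[OF z]])
      (simp_all add: cross_eq cross7.scaleR_right inner_commute flip: frame_axis_def)
  (* The cubic form f_ki . (f x f_j) is totally symmetric, as f_i . (f x f_j) = 0; it is traceless by harmonicity. *)
  have B: "pd 1 (pd 2 f) z \<bullet> cross7 (f z) (pd 1 f z) = B z"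
    and A: "pd 1 (pd 2 f) z \<bullet> cross7 (f z) (pd 2 f z) = - A z" 
    and A': "pd 2 (pd 2 f) z \<bullet> cross7 (f z) (pd 1 f z) = - A z"
    and B': "pd 2 (pd 2 f) z \<bullet> cross7 (f z) (pd 2 f z) = - B z" if z: "z \<in> S" for z
  proof -
    have tr: "pd i f z \<bullet> cross7 (f z) (pd j f z) = 0" if "z \<in> S" for i j z
      using exhaust_2[of i] exhaust_2[of j] g2_frame.inner_triple[OF frame[OF that]] by auto
    have sym: "pd k (pd i f) z \<bullet> cross7 (f z) (pd j f z) = pd k (pd j f) z \<bullet> cross7 (f z) (pd i f z)" for i j k
    proof -
      have 1: "pd k (pd i f) z \<bullet> cross7 (f z) (pd j f z)
          = - (pd i f z \<bullet> (cross7 (pd k f z) (pd j f z) + cross7 (f z) (pd k (pd j f) z)))"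
        using pd_inner_const[OF z d(2)[OF z] dc[OF z] tr, of k i j]
        by (simp add: pd_cross7 d[OF z])
      have 2: "pd i f z \<bullet> cross7 (pd k f z) (pd j f z) = 0"
        using exhaust_2[of i] exhaust_2[of j] exhaust_2[of k] by auto
      show ?thesis
        by (simp add: 1 2 inner_add_right inner_cross7_skew inner_commute[of "pd k (pd j f) z"])
    qed
    have "pd 2 (pd 2 f) z = - (2 * conf f z) *\<^sub>R f z - pd 1 (pd 1 f) z"
      using harmonic[OF z] by (simp add: algebra_simps)
    then show A': "pd 2 (pd 2 f) z \<bullet> cross7 (f z) (pd 1 f z) = - A z"
      and B': "pd 2 (pd 2 f) z \<bullet> cross7 (f z) (pd 2 f z) = - B z"
      by (simp_all add: A_def B_def inner_diff_left)
    show "pd 1 (pd 2 f) z \<bullet> cross7 (f z) (pd 1 f z) = B z"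
      by (simp add: sym[of 1 2 1] B_def)
    show "pd 1 (pd 2 f) z \<bullet> cross7 (f z) (pd 2 f z) = - A z"
      using sym[of 2 1 2] A' by (simp add: commute[OF z])
  qed
  have p: "((A z)\<^sup>2 + (B z)\<^sup>2) * p 1 z = 0" "((A z)\<^sup>2 + (B z)\<^sup>2) * p 2 z = 0" if z: "z \<in> S" for z
  proof -
    (* A linear system for (p 1, p 2) with determinant - (A^2 + B^2). *)
    have 1: "A z * p 1 z + B z * p 2 z = 0"
      using arg_cong[OF expand[OF z, of 1 1], of "\<lambda>x. n \<bullet> x"]
      by (simp add: inner_add_right nf[OF z] nf1[OF z] nf2[OF z] p_def A_def B_def)
    have 2: "B z * p 1 z - A z * p 2 z = 0"
      using arg_cong[OF expand[OF z, of 1 2], of "\<lambda>x. n \<bullet> x"]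
      by (simp add: inner_add_right inner_diff_right nf[OF z] nf1[OF z] nf2[OF z] p_def A[OF z] B[OF z])
    have "((A z)\<^sup>2 + (B z)\<^sup>2) * p 1 z = A z * (A z * p 1 z + B z * p 2 z) + B z * (B z * p 1 z - A z * p 2 z)"
      "((A z)\<^sup>2 + (B z)\<^sup>2) * p 2 z = B z * (A z * p 1 z + B z * p 2 z) - A z * (B z * p 1 z - A z * p 2 z)"
      by (simp_all add: power2_eq_square algebra_simps)
    then show "((A z)\<^sup>2 + (B z)\<^sup>2) * p 1 z = 0" "((A z)\<^sup>2 + (B z)\<^sup>2) * p 2 z = 0"
      unfolding 1 2 by simp_all
  qed
  have AB0: "A z0 \<noteq> 0 \<or> B z0 \<noteq> 0"
  proof (rule ccontr)
    assume "\<not> (A z0 \<noteq> 0 \<or> B z0 \<noteq> 0)"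
    then have AB: "A z0 = 0" "B z0 = 0"
      by auto
    have "pd i (pd j f) z0 \<bullet> cross7 (f z0) (pd k f z0) = 0" for i j k
      using exhaust_2[of i] exhaust_2[of j] exhaust_2[of k] AB A[OF z0] B[OF z0] A'[OF z0] B'[OF z0]
      by (auto simp: commute[OF z0] A_def B_def)
    then have e: "conf f z0 *\<^sub>R pd i0 (pd j0 f) z0 = (conf f z0 * (pd i0 (pd j0 f) z0 \<bullet> f z0)) *\<^sub>R f z0
      + (pd i0 (pd j0 f) z0 \<bullet> pd 1 f z0) *\<^sub>R pd 1 f z0 + (pd i0 (pd j0 f) z0 \<bullet> pd 2 f z0) *\<^sub>R pd 2 f z0"
      using expand[OF z0, of i0 j0] by simp
    have "conf f z0 *\<^sub>R pd i0 (pd j0 f) z0 \<in> span (insert (f z0) (tangent_basis f z0))"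
      unfolding e by (intro span_add span_scale span_base) (auto simp: tangent_basis_def)
    from span_scale[OF this, of "1 / conf f z0"]
    have "pd i0 (pd j0 f) z0 \<in> span (insert (f z0) (tangent_basis f z0))"
      using conf_pos[OF z0] by simp
    then show False
      using ntg by (simp add: sphere_second_ff_def normal_part_eq_0_iff)
  qed
  define T where "T = S \<inter> (\<lambda>z. (A z)\<^sup>2 + (B z)\<^sup>2) -` (- {0})"
  have "A differentiable (at z)" "B differentiable (at z)" if "z \<in> S" for z
    unfolding A_def[abs_def] B_def[abs_def]
    using bounded_bilinear.differentiable_prod[OF bounded_bilinear_inner] d[OF that] dc[OF that] by blast+
  then have "continuous_on S A" "continuous_on S B"
    by (auto intro!: continuous_at_imp_continuous_on differentiable_imp_continuous_within)
  then have T: "open T"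
    unfolding T_def by (intro continuous_open_preimage continuous_intros open_S) auto
  have z0T: "z0 \<in> T"
    using z0 AB0 by (auto simp: T_def sum_power2_eq_zero_iff)
  have pT: "p 1 z = 0" "p 2 z = 0" if "z \<in> T" for z
    using p[of z] that by (auto simp: T_def)
  have "0 = pd 2 (p 1) z0"
    using pd_eq_0_open[OF T z0T, of "p 1" 0 2] pT by simp
  also have "\<dots> = n \<bullet> (cross7 (pd 2 f z0) (pd 1 f z0) + cross7 (f z0) (pd 2 (pd 1 f) z0))"
    unfolding p_def[abs_def]
    by (simp add: bounded_linear.pd_linear[OF bounded_linear_inner_right dc[OF z0]] pd_cross7 d[OF z0])
  finally have 0: "n \<bullet> cross7 (pd 1 f z0) (pd 2 f z0) = n \<bullet> cross7 (f z0) (pd 2 (pd 1 f) z0)"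
    using cross7_skew[of "pd 2 f z0" "pd 1 f z0"] by (simp add: inner_add_right inner_diff_right)
  interpret g2_frame "f z0" "pd 1 f z0" "pd 2 f z0" "conf f z0"
    by (rule frame[OF z0])
  have "conf f z0 * (n \<bullet> cross7 (f z0) (pd 2 (pd 1 f) z0)) = n \<bullet> cross7 (f z0) (conf f z0 *\<^sub>R pd 2 (pd 1 f) z0)"
    by (simp add: cross7.scaleR_right)
  also have "\<dots> = 0"
    unfolding expand[OF z0] using pT[OF z0T] nf1[OF z0]
    by (simp add: p_def cross7.add_right cross7.scaleR_right inner_add_right inner_diff_right double_cross)
  finally have N: "n \<bullet> cross7 (pd 1 f z0) (pd 2 f z0) = 0"
    using w_pos 0 by simp
  show "n = 0"
  proof (rule complete)
    show "n \<bullet> cross7 (f z0) (cross7 (pd 1 f z0) (pd 2 f z0)) = 0"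
      using nv by (simp add: axis[OF z0] flip: frame_axis(5)[OF z0])
  qed (use nf[OF z0] nf1[OF z0] pT[OF z0T] N in \<open>simp_all add: p_def\<close>)
qed

text \<open>
  Both sides are obtained from \<open>f \<times> f\<^sub>x\<close> by rotation about \<open>v\<close>: the left side through \<open>\<pi>/6 - \<pi>/2\<close>, because
  \<open>f\<^sub>y = - v \<times> (f \<times> f\<^sub>x)\<close>, and the right side through \<open>- 2 \<pi>/6\<close>. The angle \<open>\<pi>/6\<close> is chosen so that these agree.
\<close>

lemma rotation_almost_complex:
  assumes z: "z \<in> S" and axis: "frame_axis f z = v"
  defines "f' \<equiv> \<lambda>z. rot7 v (pi / 6) (f z)"
  shows "pd 2 f' z = cross7 (f' z) (pd 1 f' z)"
proof -
  have v: "norm v = 1"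
    using frame_axis(4)[OF z] by (simp add: axis norm_eq_1)
  have pd: "pd i f' z = rot7 v (pi / 6) (pd i f z)" for i
    unfolding f'_def by (rule bounded_linear.pd_linear[OF bounded_linear_rot7 differentiable(1)[OF z]])
  let ?u = "cross7 (f z) (pd 1 f z)"
  have orth: "f z \<bullet> v = 0" "pd 1 f z \<bullet> v = 0" "?u \<bullet> v = 0"
    using frame_axis[OF z] by (simp_all add: axis inner_commute)
  have "pd 2 f z = rot7 v (- pi / 2) ?u"
    using frame_axis(6)[OF z] orth by (simp add: rot7_orthogonal axis)
  then have "pd 2 f' z = rot7 v (pi / 6 + (- pi / 2)) ?u"
    by (simp only: pd rot7_rot7[OF v])
  also have "pi / 6 + (- pi / 2) = - 2 * (pi / 6)"
    by simp
  also have "rot7 v (- 2 * (pi / 6)) ?u = cross7 (rot7 v (pi / 6) (f z)) (rot7 v (pi / 6) (pd 1 f z))"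
    using orth inner_pd[OF z] by (intro cross7_rot7_rot7[OF v, symmetric]) auto
  also have "\<dots> = cross7 (f' z) (pd 1 f' z)"
    by (simp only: pd) (simp only: f'_def)
  finally show ?thesis .
qed

text \<open>
  The sign \<open>\<epsilon>\<close> stands for the orientation. Rotating the almost complex equation back expresses \<open>f\<^sub>y\<close> through
  \<open>f \<times> f\<^sub>x\<close> rotated by \<open>3\<beta>\<close>; as \<open>f\<^sub>y\<close> is orthogonal to \<open>f \<times> f\<^sub>x\<close>, only the component along
  \<open>v \<times> (f \<times> f\<^sub>x)\<close> survives, and it determines the axis.
\<close>

lemma frame_axis_of_rotated_almost_complex:
  assumes v: "norm v = 1" and rot: "\<And>z. z \<in> S \<Longrightarrow> f z = rot7 v \<beta> (f' z)"
    and perp: "\<And>z. z \<in> S \<Longrightarrow> f' z \<bullet> v = 0"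
    and \<epsilon>: "\<epsilon> = 1 \<or> \<epsilon> = - 1"
    and z: "z \<in> S" and ac: "pd 2 f' z = \<epsilon> *\<^sub>R cross7 (f' z) (pd 1 f' z)"
  shows "frame_axis f z = - (\<epsilon> * sin (3 * \<beta>)) *\<^sub>R v"
proof -
  have vv: "v \<bullet> v = 1"
    using v by (simp add: dot_square_norm)
  let ?u = "cross7 (f z) (pd 1 f z)" and ?u' = "cross7 (f' z) (pd 1 f' z)"
  have f': "f' z = rot7 v (- \<beta>) (f z)" if "z \<in> S" for z
    using rot[OF that] by (simp add: rot7_rot7[OF v])
  have "pd i f' z = pd i (\<lambda>z. rot7 v (- \<beta>) (f z)) z" for i
    using f' by (rule pd_cong_open[OF open_S z])
  then have pd': "pd i f' z = rot7 v (- \<beta>) (pd i f z)" for i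
    by (simp add: bounded_linear.pd_linear[OF bounded_linear_rot7 differentiable(1)[OF z]])
  then have pd: "pd i f z = rot7 v \<beta> (pd i f' z)" for i
    by (simp add: rot7_rot7[OF v])
  have fv: "f z \<bullet> v = 0" if "z \<in> S" for z
    using perp[OF that] rot[OF that] by (simp add: rot7_inner_axis[OF v])
  have pdv: "pd i f z \<bullet> v = 0" for i
    using pd_inner_const[OF z differentiable(1)[OF z] differentiable_const fv] by simp
  then have pd'v: "pd i f' z \<bullet> v = 0" for i
    by (simp add: pd' rot7_inner_axis[OF v])
  (* The almost complex equation itself shows that the product is orthogonal to v. *)
  have u'v: "?u' \<bullet> v = 0"
    using pd'v[of 2] \<epsilon> by (auto simp: ac)
  have "f' z \<bullet> pd 1 f' z = 0"
    using inner_pd[OF z] by (simp add: f'[OF z] pd' inner_rot7_rot7[OF v])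
  then have u: "?u = rot7 v (- 2 * \<beta>) ?u'"
    unfolding pd rot[OF z] using perp[OF z] pd'v u'v by (intro cross7_rot7_rot7[OF v]) auto
  then have uv: "?u \<bullet> v = 0"
    using u'v by (simp add: rot7_inner_axis[OF v])
  have "?u' = rot7 v (2 * \<beta>) ?u"
    by (simp add: u rot7_rot7[OF v])
  then have "pd 2 f z = \<epsilon> *\<^sub>R rot7 v (\<beta> + 2 * \<beta>) ?u"
    by (simp add: pd[of 2] ac linear_cmul[OF linear_rot7] rot7_rot7[OF v])
  then have fy: "pd 2 f z = \<epsilon> *\<^sub>R (cos (3 * \<beta>) *\<^sub>R ?u + sin (3 * \<beta>) *\<^sub>R cross7 v ?u)"
    by (simp add: rot7_orthogonal uv)
  interpret g2_frame "f z" "pd 1 f z" "pd 2 f z" "conf f z"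
    by (rule frame[OF z])
  have "pd 2 f z \<bullet> ?u = \<epsilon> * cos (3 * \<beta>) * conf f z"
    by (subst fy) (simp add: inner_add_left inner_products)
  then have "cos (3 * \<beta>) = 0"
    using \<epsilon> w_pos by auto
  then have fy: "pd 2 f z = (\<epsilon> * sin (3 * \<beta>)) *\<^sub>R cross7 v ?u"
    using fy by simp
  have "conf f z *\<^sub>R frame_axis f z = cross7 (pd 2 f z) ?u"
    by (simp add: cross_b_fa frame_axis(5)[OF z])
  also have "\<dots> = (\<epsilon> * sin (3 * \<beta>)) *\<^sub>R cross7 (cross7 v ?u) ?u"
    by (subst fy) (simp add: cross7.scaleR_left)
  also have "cross7 (cross7 v ?u) ?u = cross7 ?u (cross7 ?u v)"
    using cross7_skew[of "cross7 v ?u" ?u] cross7_skew[of v ?u] by (simp add: cross7.minus_right)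
  also have "\<dots> = - conf f z *\<^sub>R v"
    by (simp add: cross7_cross7_same uv inner_products)
  finally have eq: "conf f z *\<^sub>R frame_axis f z = conf f z *\<^sub>R (- (\<epsilon> * sin (3 * \<beta>)) *\<^sub>R v)"
    by (simp add: mult.commute)
  show ?thesis
    using iffD1[OF scaleR_cancel_left eq] w_pos by auto
qed

end

section \<open>Changes of coordinate\<close>

lemma sphere_valued_derivatives:
  fixes f :: "complex \<Rightarrow> 'b::euclidean_space"
  assumes S: "open S" and z: "z \<in> S" and f: "\<And>z. z \<in> S \<Longrightarrow> f differentiable (at z)"
    and f1: "\<And>z. z \<in> S \<Longrightarrow> pd i f differentiable (at z)"
    and unit: "\<And>z. z \<in> S \<Longrightarrow> f z \<bullet> f z = 1"
  shows "pd i (pd i f) z \<bullet> f z = - (pd i f z \<bullet> pd i f z)"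
proof -
  have 1: "f z \<bullet> pd i f z = 0" if z: "z \<in> S" for z
  proof -
    have "pd i f z \<bullet> f z + f z \<bullet> pd i f z = 0"
      unfolding pd_inner[OF f[OF z] f[OF z], symmetric]
      using unit by (intro pd_eq_0_open[OF S z])
    then show ?thesis
      by (simp add: inner_commute)
  qed
  have "pd i f z \<bullet> pd i f z + f z \<bullet> pd i (pd i f) z = 0"
    unfolding pd_inner[OF f[OF z] f1[OF z], symmetric]
    using 1 by (intro pd_eq_0_open[OF S z])
  then show ?thesis
    by (simp add: inner_commute)
qed

text \<open>
  The quotient in the definition of the Kaehler angle is at most \<open>1\<close> in absolute value by the Cauchy-Schwarz
  inequality, so that \<open>arccos\<close> can be inverted.
\<close>

lemma kaehler_angle_half_pi_imp:
  assumes "norm (f z) = 1" "pd 1 f z \<bullet> pd 2 f z = 0" "norm (pd 1 f z) = norm (pd 2 f z)" "pd 1 f z \<noteq> 0"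
    and angle: "kaehler_angle f z = pi / 2"
  shows "f z \<bullet> cross7 (pd 1 f z) (pd 2 f z) = 0"
proof -
  let ?a = "pd 1 f z" and ?b = "pd 2 f z"
  have "(norm (cross7 ?a ?b))\<^sup>2 = ((norm ?a)\<^sup>2)\<^sup>2"
    using inner_cross7_cross7[of ?a ?b ?b] assms
    by (simp add: power2_norm_eq_inner[symmetric] power2_eq_square[of "_\<^sup>2"])
  then have "norm (cross7 ?a ?b) = (norm ?a)\<^sup>2"
    by (rule power2_eq_imp_eq) simp_all
  then have "\<bar>f z \<bullet> cross7 ?a ?b\<bar> \<le> (norm ?a)\<^sup>2"
    using Cauchy_Schwarz_ineq2[of "f z" "cross7 ?a ?b"] assms by simp
  then have "\<bar>f z \<bullet> cross7 ?a ?b / (norm ?a)\<^sup>2\<bar> \<le> 1"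
    using assms(4) by (simp add: abs_divide)
  then have "f z \<bullet> cross7 ?a ?b / (norm ?a)\<^sup>2 = cos (kaehler_angle f z)"
    by (simp add: kaehler_angle_def cos_arccos_abs)
  then have "f z \<bullet> cross7 ?a ?b / (norm ?a)\<^sup>2 = 0"
    by (simp add: angle)
  then show ?thesis
    using assms(4) by simp
qed

text \<open>
  By the Cauchy-Riemann equations \<open>|\<tau>'|\<^sup>2\<close> multiplies both \<open>f\<^sub>x \<times> f\<^sub>y\<close> and the conformal factor, so it cancels
  in the unit normal.
\<close>

lemma frame_axis_reparametrize:
  assumes T: "open T" "z \<in> T" "\<And>w. w \<in> T \<Longrightarrow> g w = f (\<tau> w)"
    and d: "(\<tau> has_field_derivative d) (at z)" and f: "f differentiable (at (\<tau> z))"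
    and conformal: "pd 1 f (\<tau> z) \<bullet> pd 2 f (\<tau> z) = 0"
      "pd 2 f (\<tau> z) \<bullet> pd 2 f (\<tau> z) = pd 1 f (\<tau> z) \<bullet> pd 1 f (\<tau> z)"
    and immersed: "pd 1 g z \<noteq> 0"
  shows "frame_axis g z = frame_axis f (\<tau> z)"
proof -
  let ?a = "pd 1 f (\<tau> z)" and ?b = "pd 2 f (\<tau> z)"
  let ?J = "(Re d)\<^sup>2 + (Im d)\<^sup>2"
  have \<tau>: "(\<tau> has_derivative (\<lambda>h. d * h)) (at z)"
    using d by (simp add: has_field_derivative_def)
  have "((\<lambda>w. f (\<tau> w)) has_derivative (\<lambda>h. Re (d * h) *\<^sub>R ?a + Im (d * h) *\<^sub>R ?b)) (at z)"
    using has_derivative_compose[OF \<tau> has_derivative_pd[OF f]] .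
  then have "pd i (\<lambda>w. f (\<tau> w)) z = Re (d * (if i = 1 then 1 else \<i>)) *\<^sub>R ?a + Im (d * (if i = 1 then 1 else \<i>)) *\<^sub>R ?b" for i
    by (rule pd_eqI)
  moreover have "pd i g z = pd i (\<lambda>w. f (\<tau> w)) z" for i
    by (rule pd_cong_open[OF T])
  ultimately have pd: "pd 1 g z = Re d *\<^sub>R ?a + Im d *\<^sub>R ?b" "pd 2 g z = - Im d *\<^sub>R ?a + Re d *\<^sub>R ?b"
    by simp_all
  have "cross7 (pd 1 g z) (pd 2 g z) = (Re d * Re d) *\<^sub>R cross7 ?a ?b + (Im d * Im d) *\<^sub>R cross7 ?a ?b"
    by (simp add: pd cross7.add_left cross7.add_right cross7.diff_right cross7.scaleR_left
        cross7.scaleR_right cross7.minus_right cross7_skew[of ?b ?a])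
  then have cross: "cross7 (pd 1 g z) (pd 2 g z) = ?J *\<^sub>R cross7 ?a ?b"
    by (simp add: power2_eq_square scaleR_left_distrib)
  have conf: "conf g z = ?J * conf f (\<tau> z)"
    using conformal by (simp add: conf_def pd inner_simps inner_commute[of ?b ?a] power2_eq_square distrib_right)
  moreover have "conf g z \<noteq> 0"
    using immersed by (simp add: conf_def)
  ultimately have "?J \<noteq> 0"
    by auto
  then have "unit_normal g z = unit_normal f (\<tau> z)"
    by (simp add: unit_normal_def cross conf)
  moreover have "g z = f (\<tau> z)"
    using T by blast
  ultimately show ?thesis
    by (simp add: frame_axis_def)
qed

lemma pd_compose_cnj:
  assumes "f differentiable (at z)"
  shows "pd i (\<lambda>w. f (cnj w)) (cnj z) = (if i = 1 then 1 else - 1 :: real) *\<^sub>R pd i f z"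
proof -
  have "((\<lambda>w. f (cnj w)) has_derivative (\<lambda>h. Re (cnj h) *\<^sub>R pd 1 f z + Im (cnj h) *\<^sub>R pd 2 f z)) (at (cnj z))"
    by (rule has_derivative_compose[OF bounded_linear_imp_has_derivative[OF bounded_linear_cnj]])
      (use has_derivative_pd[OF assms] in simp)
  from pd_eqI[OF this, of i] show ?thesis
    using exhaust_2[of i] by auto
qed

text \<open>
  All level sets and their complements are open.
\<close>

lemma locally_constant_imp_constant:
  assumes "connected_space X"
    and "\<And>p. p \<in> topspace X \<Longrightarrow> \<exists>W. openin X W \<and> p \<in> W \<and> (\<forall>q\<in>W. k q = k p)"
  shows "k constant_on topspace X"
proof (cases "topspace X = {}")
  case False
  then obtain p0 where p0: "p0 \<in> topspace X"
    by blast
  have op: "openin X {p \<in> topspace X. P (k p)}" for P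
  proof (rule iffD2[OF openin_subopen], rule ballI)
    fix p assume p: "p \<in> {p \<in> topspace X. P (k p)}"
    then obtain W where W: "openin X W" "p \<in> W" "\<forall>q\<in>W. k q = k p"
      using assms(2)[of p] by auto
    have "W \<subseteq> {p \<in> topspace X. P (k p)}"
      using openin_subset[OF W(1)] W(3) p by auto
    then show "\<exists>T. openin X T \<and> p \<in> T \<and> T \<subseteq> {p \<in> topspace X. P (k p)}"
      using W by blast
  qed
  let ?E = "{p \<in> topspace X. k p = k p0}"
  have "topspace X - ?E = {p \<in> topspace X. k p \<noteq> k p0}"
    by blast
  then have cl: "closedin X ?E"
    using op[of "\<lambda>y. y \<noteq> k p0"] by (simp add: closedin_def)
  have "?E = {} \<or> ?E = topspace X"
    by (rule connected_space_clopen_in[THEN iffD1, OF assms(1), rule_format,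
        OF conjI[OF op[of "\<lambda>y. y = k p0"] cl]])
  moreover have "p0 \<in> ?E"
    using p0 by simp
  ultimately have "?E = topspace X"
    by blast
  then show ?thesis
    unfolding constant_on_def by blast
qed (simp add: constant_on_def)

lemma zero_pd_imp_locally_constant:
  fixes g :: "complex \<Rightarrow> 'b::real_normed_vector"
  assumes "open S" "z \<in> S" "\<And>w. w \<in> S \<Longrightarrow> g differentiable (at w)" "\<And>w i. w \<in> S \<Longrightarrow> pd i g w = 0"
  shows "\<exists>e>0. ball z e \<subseteq> S \<and> (\<forall>w\<in>ball z e. g w = g z)"
proof -
  obtain e where e: "e > 0" "ball z e \<subseteq> S"
    using assms open_contains_ball by blast
  have "\<exists>c. \<forall>w\<in>ball z e. g w = c"
  proof (rule has_derivative_zero_constant)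
    show "(g has_derivative (\<lambda>h. 0)) (at w within ball z e)" if "w \<in> ball z e" for w
      using has_derivative_pd[OF assms(3), of w] assms(4)[of w] subsetD[OF e(2) that]
      by (simp add: has_derivative_at_withinI)
  qed simp
  then show ?thesis
    using e centre_in_ball by metis
qed

lemma inv_into_cnj: "inv_into U (cnj \<circ> \<psi>) z = inv_into U \<psi> (cnj z)"
proof -
  have "cnj (\<psi> y) = z \<longleftrightarrow> \<psi> y = cnj z" for y
    using complex_cnj_cnj by metis
  then show ?thesis
    by (simp add: inv_into_def)
qed

text \<open>
  Conjugating the coordinate changes second derivatives by signs only and preserves the tangent plane.
\<close>

lemma sphere_second_ff_compose_cnj:
  assumes S: "open S" "z \<in> S" and f: "\<And>w. w \<in> S \<Longrightarrow> f differentiable (at w)"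
    and f1: "\<And>i. pd i f differentiable (at z)"
    and flat: "sphere_second_ff (\<lambda>w. f (cnj w)) (cnj z) i j = 0"
  shows "sphere_second_ff f z i j = 0"
proof -
  let ?g = "\<lambda>w. f (cnj w)"
  define s :: "2 \<Rightarrow> real" where "s i = (if i = 1 then 1 else - 1)" for i
  have s: "s i * s i = 1" for i
    by (simp add: s_def)
  have "cnj ` S = cnj -` S"
    by (auto simp: image_iff) (metis complex_cnj_cnj)
  then have openS: "open (cnj ` S)"
    using S(1) by (simp add: open_vimage continuous_on_cnj)
  have pd1: "pd j ?g w = s j *\<^sub>R pd j f (cnj w)" if "w \<in> cnj ` S" for j w
    using that pd_compose_cnj[OF f, of "cnj w" j] by (auto simp: s_def)
  have "pd i (pd j ?g) (cnj z) = pd i (\<lambda>w. s j *\<^sub>R pd j f (cnj w)) (cnj z)"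
    using S(2) by (intro pd_cong_open[OF openS _ pd1]) auto
  also have "\<dots> = s i *\<^sub>R s j *\<^sub>R pd i (pd j f) z"
    using pd_compose_cnj[of "\<lambda>w. s j *\<^sub>R pd j f w" z i] f1[of j]
    by (simp add: s_def pd_scaleR_right differentiable_scaleR)
  finally have pd2: "pd i (pd j ?g) (cnj z) = (s i * s j) *\<^sub>R pd i (pd j f) z"
    by simp
  let ?T = "insert (f z) (tangent_basis f z)"
  have "insert (?g (cnj z)) (tangent_basis ?g (cnj z)) \<subseteq> span ?T"
    using S(2) by (auto simp: tangent_basis_def pd1 intro!: span_scale intro: span_base)
  then have "span (insert (?g (cnj z)) (tangent_basis ?g (cnj z))) \<subseteq> span ?T"
    by (rule span_minimal) (rule subspace_span)
  moreover have "(s i * s j) *\<^sub>R pd i (pd j f) z \<in> span (insert (?g (cnj z)) (tangent_basis ?g (cnj z)))"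
    using flat by (simp add: sphere_second_ff_def normal_part_eq_0_iff pd2)
  ultimately have "(s i * s j) *\<^sub>R (s i * s j) *\<^sub>R pd i (pd j f) z \<in> span ?T"
    by (blast intro: span_scale)
  moreover have "(s i * s j) * (s i * s j) = 1"
    by (simp add: s_def)
  ultimately show ?thesis
    by (simp add: sphere_second_ff_def normal_part_eq_0_iff)
qed

section \<open>From coordinates to the Riemann surface\<close>

lemma in_coords_iff:
  "in_coords A P f \<longleftrightarrow> (\<forall>U \<psi> z. (U, \<psi>) \<in> A \<longrightarrow> z \<in> \<psi> ` U \<longrightarrow> P (f \<circ> inv_into U \<psi>) z)"
  unfolding in_coords_def by blast

lemma in_coordsI:
  "(\<And>U \<psi> z. (U, \<psi>) \<in> A \<Longrightarrow> z \<in> \<psi> ` U \<Longrightarrow> P (f \<circ> inv_into U \<psi>) z) \<Longrightarrow> in_coords A P f"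
  unfolding in_coords_iff by blast

lemma in_coordsD:
  "in_coords A P f \<Longrightarrow> (U, \<psi>) \<in> A \<Longrightarrow> z \<in> \<psi> ` U \<Longrightarrow> P (f \<circ> inv_into U \<psi>) z"
  unfolding in_coords_iff by blast

lemma in_coords_conj_cong:
  assumes "\<And>U \<psi> z. (U, \<psi>) \<in> A \<Longrightarrow> z \<in> \<psi> ` U \<Longrightarrow>
    P (f \<circ> inv_into U \<psi>) z \<and> Q (g \<circ> inv_into U \<psi>) z \<longleftrightarrow> R (h \<circ> inv_into U \<psi>) z"
  shows "in_coords A P f \<and> in_coords A Q g \<longleftrightarrow> in_coords A R h"
  unfolding in_coords_iff using assms by blast

text \<open>
  The local form of the condition that the axis is constant, and the common middle term of both directions of
  the classification.
\<close>

definition axis_stationary :: "'a atlas \<Rightarrow> ('a \<Rightarrow> real ^ 7) \<Rightarrow> bool" where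
  "axis_stationary A \<phi> \<longleftrightarrow> in_coords A (\<lambda>g z. \<forall>i. pd i (frame_axis g) z = 0) \<phi>"

context
  fixes X :: "'a topology" and A :: "'a atlas"
  assumes surface: "riemann_surface X A"
begin

lemma chart:
  assumes "(U, \<psi>) \<in> A"
  shows "openin X U" "U \<subseteq> topspace X" "open (\<psi> ` U)" "inj_on \<psi> U"
    "homeomorphic_map (subtopology X U) (top_of_set (\<psi> ` U)) \<psi>"
proof -
  show *: "openin X U" "open (\<psi> ` U)" "homeomorphic_map (subtopology X U) (top_of_set (\<psi> ` U)) \<psi>"
    using surface assms unfolding riemann_surface_def by auto
  show "U \<subseteq> topspace X"
    using * openin_subset by blast
  then show "inj_on \<psi> U"
    using homeomorphic_imp_injective_map[OF *(3)] by (simp add: topspace_subtopology Int_absorb1)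
qed

lemma chart_exists:
  assumes "p \<in> topspace X"
  obtains U \<psi> where "(U, \<psi>) \<in> A" "p \<in> U"
  using surface assms unfolding riemann_surface_def by blast

lemma chart_image_open:
  assumes "(U, \<psi>) \<in> A" "openin X W" "W \<subseteq> U"
  shows "open (\<psi> ` W)"
proof -
  have "openin (subtopology X U) W"
    unfolding openin_subtopology using assms(2,3) by blast
  then have "openin (top_of_set (\<psi> ` U)) (\<psi> ` W)"
    using homeomorphic_imp_open_map[OF chart(5)[OF assms(1)]] by (simp add: open_map_def)
  then show ?thesis
    using chart(3)[OF assms(1)] openin_open_trans by blast
qed

lemma chart_preimage_open:
  assumes "(U, \<psi>) \<in> A" "open T"
  shows "openin X {p \<in> U. \<psi> p \<in> T}"
proof -
  have "openin (top_of_set (\<psi> ` U)) (\<psi> ` U \<inter> T)"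
    using assms by (simp add: openin_open_Int)
  then have "openin (subtopology X U) {p \<in> topspace (subtopology X U). \<psi> p \<in> \<psi> ` U \<inter> T}"
    using homeomorphic_imp_continuous_map[OF chart(5)[OF assms(1)]] openin_continuous_map_preimage by blast
  also have "{p \<in> topspace (subtopology X U). \<psi> p \<in> \<psi> ` U \<inter> T} = {p \<in> U. \<psi> p \<in> T}"
    using chart(2)[OF assms(1)] by (auto simp: topspace_subtopology)
  finally show ?thesis
    by (rule openin_trans_full) (rule chart(1)[OF assms(1)])
qed

context
  fixes \<phi> :: "'a \<Rightarrow> real ^ 7"
  assumes immersion: "totally_real_minimal_immersion X A \<phi>"
begin

text \<open>
  The tension field vanishes iff the Laplacian is a multiple of \<open>f\<close>; the multiple is found by differentiating
  \<open>f \<bullet> f = 1\<close> twice.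
\<close>

lemma minimal_chart:
  assumes c: "(U, \<psi>) \<in> A"
  shows "totally_real_minimal_chart (\<psi> ` U) (\<phi> \<circ> inv_into U \<psi>)"
proof -
  let ?f = "\<phi> \<circ> inv_into U \<psi>" and ?S = "\<psi> ` U"
  have sphere: "\<phi> ` topspace X \<subseteq> sphere 0 1"
    and smooth: "smooth_map A \<phi>"
    and inj: "in_coords A (\<lambda>g z. inj (frechet_derivative g (at z))) \<phi>"
    and conf: "in_coords A (\<lambda>g z. pd 1 g z \<bullet> pd 2 g z = 0 \<and> norm (pd 1 g z) = norm (pd 2 g z)) \<phi>"
    and tension: "in_coords A (\<lambda>g z. sphere_tension g z = 0) \<phi>"
    and angle: "in_coords A (\<lambda>g z. kaehler_angle g z = pi / 2) \<phi>"
    using immersion unfolding totally_real_minimal_immersion_def conformal_immersion_def by auto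
  have Ck: "Ck_on k ?S ?f" for k
    using smooth c unfolding smooth_map_def by auto
  have d: "?f differentiable (at z)" "pd i ?f differentiable (at z)" if "z \<in> ?S" for i z
    using Ck[of "Suc (Suc 0)"] that by auto
  have norm1: "norm (?f z) = 1" if "z \<in> ?S" for z
  proof -
    have "?f z \<in> sphere 0 1"
      using subsetD[OF chart(2)[OF c] inv_into_into[OF that]] sphere by auto
    then show ?thesis by simp
  qed
  have conformal: "pd 1 ?f z \<bullet> pd 2 ?f z = 0" "norm (pd 1 ?f z) = norm (pd 2 ?f z)" if "z \<in> ?S" for z
    using conf c that unfolding in_coords_def by fast+
  have immersed: "pd 1 ?f z \<noteq> 0" if z: "z \<in> ?S" for z
  proof
    assume "pd 1 ?f z = 0"
    then have "frechet_derivative ?f (at z) 1 = frechet_derivative ?f (at z) 0"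
      using linear_0[OF linear_frechet_derivative[OF d(1)[OF z]]] by (simp add: pd_def)
    moreover have "inj (frechet_derivative ?f (at z))"
      using inj c z unfolding in_coords_def by fast
    ultimately show False
      by (simp add: inj_eq)
  qed
  show ?thesis
  proof
    show "open ?S" by (rule chart(3)[OF c])
    show "Ck_on k ?S ?f" for k by (rule Ck)
    fix z assume z: "z \<in> ?S"
    show unit: "?f z \<bullet> ?f z = 1" and "pd 1 ?f z \<bullet> pd 2 ?f z = 0"
      and conf22: "pd 2 ?f z \<bullet> pd 2 ?f z = pd 1 ?f z \<bullet> pd 1 ?f z" and "pd 1 ?f z \<noteq> 0"
      using norm1[OF z] conformal[OF z] immersed[OF z] by (simp_all add: dot_square_norm)
    have "kaehler_angle ?f z = pi / 2"
      using angle c z unfolding in_coords_def by fast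
    then show "?f z \<bullet> cross7 (pd 1 ?f z) (pd 2 ?f z) = 0"
      using norm1[OF z] conformal[OF z] immersed[OF z] kaehler_angle_half_pi_imp by blast
    let ?L = "pd 1 (pd 1 ?f) z + pd 2 (pd 2 ?f) z"
    have "sphere_tension ?f z = 0"
      using tension c z unfolding in_coords_def by fast
    then obtain k where k: "?L = k *\<^sub>R ?f z"
      unfolding sphere_tension_def normal_part_eq_0_iff span_singleton by blast
    have "pd i (pd i ?f) z \<bullet> ?f z = - (pd i ?f z \<bullet> pd i ?f z)" for i
      using d norm1 by (intro sphere_valued_derivatives[OF chart(3)[OF c] z]) (simp_all add: dot_square_norm)
    then have "?L \<bullet> ?f z = - (2 * conf ?f z)"
      using conf22 by (simp add: inner_add_left conf_def)
    then have "k = - (2 * conf ?f z)"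
      using unit by (simp only: k inner_scaleR_left mult_1_right)
    then show "?L = - (2 * conf ?f z) *\<^sub>R ?f z"
      using k by simp
  qed
qed

lemma frame_axis_chart_independent:
  assumes c: "(U, \<psi>) \<in> A" "(V, \<eta>) \<in> A" and p: "p \<in> U" "p \<in> V"
  shows "frame_axis (\<phi> \<circ> inv_into U \<psi>) (\<psi> p) = frame_axis (\<phi> \<circ> inv_into V \<eta>) (\<eta> p)"
proof -
  let ?\<tau> = "\<eta> \<circ> inv_into U \<psi>" and ?T = "\<psi> ` (U \<inter> V)"
  have T: "open ?T"
    using chart_image_open[OF c(1)] chart(1)[OF c(1)] chart(1)[OF c(2)] by (simp add: openin_Int)
  have "?\<tau> holomorphic_on ?T"
    using surface c unfolding riemann_surface_def by fast
  then obtain d where d: "(?\<tau> has_field_derivative d) (at (\<psi> p))"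
    using p by (auto simp: holomorphic_on_open[OF T])
  have \<tau>p: "?\<tau> (\<psi> p) = \<eta> p"
    using chart(4)[OF c(1)] p by simp
  have pV: "\<eta> p \<in> \<eta> ` V" and pU: "\<psi> p \<in> \<psi> ` U"
    using p by auto
  note V = totally_real_minimal_chart.differentiable(1)[OF minimal_chart[OF c(2)] pV]
    totally_real_minimal_chart.conformal[OF minimal_chart[OF c(2)] pV]
    totally_real_minimal_chart.immersed[OF minimal_chart[OF c(1)] pU]
  have "frame_axis (\<phi> \<circ> inv_into U \<psi>) (\<psi> p) = frame_axis (\<phi> \<circ> inv_into V \<eta>) (?\<tau> (\<psi> p))"
  proof (rule frame_axis_reparametrize[OF T _ _ d])
    show "\<psi> p \<in> ?T"
      using p by blast
    show "(\<phi> \<circ> inv_into U \<psi>) w = (\<phi> \<circ> inv_into V \<eta>) (?\<tau> w)" if "w \<in> ?T" for w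
      using that chart(4)[OF c(1)] chart(4)[OF c(2)] by auto
  qed (simp_all only: \<tau>p V not_False_eq_True)
  then show ?thesis
    by (simp only: \<tau>p)
qed

text \<open>
  The axis is a function on the surface, since it does not depend on the chart, and it is locally constant.
\<close>

lemma stationary_imp_constant_axis:
  assumes "axis_stationary A \<phi>"
  shows "\<exists>v. in_coords A (\<lambda>g z. frame_axis g z = v) \<phi>"
proof -
  (* The axis at p, computed in an arbitrarily chosen chart around p. *)
  define k where "k p = (let (U, \<psi>) = (SOME c. c \<in> A \<and> p \<in> fst c) in frame_axis (\<phi> \<circ> inv_into U \<psi>) (\<psi> p))" for p
  have k: "k p = frame_axis (\<phi> \<circ> inv_into U \<psi>) (\<psi> p)" if "(U, \<psi>) \<in> A" "p \<in> U" for U \<psi> p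
  proof -
    obtain V \<eta> where V: "(SOME c. c \<in> A \<and> p \<in> fst c) = (V, \<eta>)"
      by (rule prod.exhaust)
    have c: "(V, \<eta>) \<in> A" "p \<in> V"
      using someI[of "\<lambda>c. c \<in> A \<and> p \<in> fst c" "(U, \<psi>)"] that V by auto
    show ?thesis
      using frame_axis_chart_independent[OF c(1) that(1) c(2) that(2)] by (simp only: k_def V Let_def prod.case)
  qed
  have "k constant_on topspace X"
  proof (rule locally_constant_imp_constant)
    show "connected_space X"
      using surface by (simp add: riemann_surface_def)
    fix p assume "p \<in> topspace X"
    then obtain U \<psi> where c: "(U, \<psi>) \<in> A" "p \<in> U"
      by (rule chart_exists)
    interpret totally_real_minimal_chart "\<psi> ` U" "\<phi> \<circ> inv_into U \<psi>"
      by (rule minimal_chart[OF c(1)])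
    let ?g = "frame_axis (\<phi> \<circ> inv_into U \<psi>)"
    have "\<exists>e>0. ball (\<psi> p) e \<subseteq> \<psi> ` U \<and> (\<forall>w\<in>ball (\<psi> p) e. ?g w = ?g (\<psi> p))"
      by (rule zero_pd_imp_locally_constant[OF open_S imageI[OF c(2)]])
        (use differentiable_frame_axis in_coordsD[OF assms[unfolded axis_stationary_def] c(1)] in blast)+
    then obtain e where e: "e > 0" "\<forall>w\<in>ball (\<psi> p) e. ?g w = ?g (\<psi> p)"
      by (elim exE conjE) (rule that)
    have "k q = k p" if "q \<in> {q \<in> U. \<psi> q \<in> ball (\<psi> p) e}" for q
    proof -
      have "q \<in> U" "?g (\<psi> q) = ?g (\<psi> p)"
        using that e(2) by simp_all
      then show ?thesis
        by (simp only: k[OF c] k[OF c(1)])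
    qed
    moreover have "p \<in> {q \<in> U. \<psi> q \<in> ball (\<psi> p) e}"
      using c(2) e(1) by simp
    ultimately show "\<exists>W. openin X W \<and> p \<in> W \<and> (\<forall>q\<in>W. k q = k p)"
      using chart_preimage_open[OF c(1) open_ball] by blast
  qed
  then obtain v where v: "\<forall>p\<in>topspace X. k p = v"
    unfolding constant_on_def by blast
  have "in_coords A (\<lambda>g z. frame_axis g z = v) \<phi>"
  proof (rule in_coordsI)
    fix U \<psi> z assume c: "(U, \<psi>) \<in> A" "z \<in> \<psi> ` U"
    then obtain q where q: "q \<in> U" "z = \<psi> q"
      by blast
    then have "k q = v"
      using v chart(2)[OF c(1)] by blast
    then show "frame_axis (\<phi> \<circ> inv_into U \<psi>) z = v"
      by (simp only: k[OF c(1) q(1)] q(2))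
  qed
  then show ?thesis
    by blast
qed

section \<open>The classification\<close>

lemma totally_geodesic_axis_stationary:
  assumes B: "B \<in> {A, conj_atlas A}" and tg: "totally_geodesic B \<phi>"
  shows "axis_stationary A \<phi>"
  unfolding axis_stationary_def
proof (intro in_coordsI allI)
  fix U \<psi> z i
  assume c: "(U, \<psi>) \<in> A" and z: "z \<in> \<psi> ` U"
  let ?f = "\<phi> \<circ> inv_into U \<psi>"
  interpret totally_real_minimal_chart "\<psi> ` U" ?f
    by (rule minimal_chart[OF c])
  note flat = in_coordsD[OF tg[unfolded totally_geodesic_def], rule_format]
  have "sphere_second_ff ?f z i j = 0" for i j
  proof (cases "B = A")
    case True
    then show ?thesis
      using flat c z by blast
  next
    case False
    then have "(U, cnj \<circ> \<psi>) \<in> B"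
      using B c by (force simp: conj_atlas_def)
    moreover have "cnj z \<in> (cnj \<circ> \<psi>) ` U"
      using z by auto
    ultimately have "sphere_second_ff (\<phi> \<circ> inv_into U (cnj \<circ> \<psi>)) (cnj z) i j = 0"
      by (rule flat)
    also have "\<phi> \<circ> inv_into U (cnj \<circ> \<psi>) = (\<lambda>w. ?f (cnj w))"
      by (simp add: fun_eq_iff inv_into_cnj)
    finally show ?thesis
      by (intro sphere_second_ff_compose_cnj[OF open_S z differentiable(1) differentiable(2)[OF z]])
  qed
  then show "pd i (frame_axis ?f) z = 0"
    by (rule totally_geodesic_imp_stationary[OF z])
qed

text \<open>
  In a chart of \<open>A\<close> the almost complex equation holds with sign \<open>1\<close> or \<open>- 1\<close>, according to
  whether it was assumed for \<open>A\<close> or for the conjugate atlas.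
\<close>

lemma rotated_almost_complex_axis_stationary:
  assumes B: "B \<in> {A, conj_atlas A}" and v: "norm v = 1"
    and ac: "almost_complex_curve X B \<phi>'" and perp: "\<phi>' ` topspace X \<subseteq> {x. x \<bullet> v = 0}"
    and rot: "\<And>p. p \<in> topspace X \<Longrightarrow> \<phi> p = rot7 v \<beta> (\<phi>' p)"
  shows "axis_stationary A \<phi>"
  unfolding axis_stationary_def
proof (intro in_coordsI allI)
  fix U \<psi> z i
  assume c: "(U, \<psi>) \<in> A" and z0: "z \<in> \<psi> ` U"
  let ?f = "\<phi> \<circ> inv_into U \<psi>" and ?f' = "\<phi>' \<circ> inv_into U \<psi>"
  interpret totally_real_minimal_chart "\<psi> ` U" ?f
    by (rule minimal_chart[OF c])
  have inX: "inv_into U \<psi> z \<in> topspace X" if "z \<in> \<psi> ` U" for z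
    using chart(2)[OF c] inv_into_into[OF that] by blast
  have acB: "in_coords B (\<lambda>g z. pd 2 g z = cross7 (g z) (pd 1 g z)) \<phi>'"
    and smoothB: "smooth_map B \<phi>'"
    using ac unfolding almost_complex_curve_def by auto
  obtain \<epsilon> :: real where \<epsilon>: "\<epsilon> = 1 \<or> \<epsilon> = - 1"
    and pd: "\<And>z. z \<in> \<psi> ` U \<Longrightarrow> pd 2 ?f' z = \<epsilon> *\<^sub>R cross7 (?f' z) (pd 1 ?f' z)"
  proof (cases "B = A")
    case True
    have "pd 2 ?f' z = cross7 (?f' z) (pd 1 ?f' z)" if "z \<in> \<psi> ` U" for z
      using acB c that unfolding True by (rule in_coordsD)
    then show ?thesis
      using that[of 1] by simp
  next
    case False
    then have c': "(U, cnj \<circ> \<psi>) \<in> B"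
      using B c by (force simp: conj_atlas_def)
    let ?g = "\<lambda>w. ?f' (cnj w)"
    have g: "\<phi>' \<circ> inv_into U (cnj \<circ> \<psi>) = ?g"
      by (simp add: fun_eq_iff inv_into_cnj)
    have "pd 2 ?f' z = - cross7 (?f' z) (pd 1 ?f' z)" if z: "z \<in> \<psi> ` U" for z
    proof -
      have z': "cnj z \<in> (cnj \<circ> \<psi>) ` U"
        using z by auto
      have "Ck_on (Suc 0) ((cnj \<circ> \<psi>) ` U) (\<phi>' \<circ> inv_into U (cnj \<circ> \<psi>))"
        using smoothB c' unfolding smooth_map_def by fast
      then have "\<forall>w\<in>(cnj \<circ> \<psi>) ` U. ?g differentiable (at w)"
        unfolding g Ck_on.simps by (rule conjunct1)
      then have d: "?g differentiable (at (cnj z))"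
        using z' by (rule bspec)
      have "pd 2 (\<phi>' \<circ> inv_into U (cnj \<circ> \<psi>)) (cnj z)
          = cross7 ((\<phi>' \<circ> inv_into U (cnj \<circ> \<psi>)) (cnj z)) (pd 1 (\<phi>' \<circ> inv_into U (cnj \<circ> \<psi>)) (cnj z))"
        using acB c' z' by (rule in_coordsD)
      then have "pd 2 ?g (cnj z) = cross7 (?f' z) (pd 1 ?g (cnj z))"
        unfolding g by simp
      moreover have "pd 1 ?f' z = pd 1 ?g (cnj z)" "pd 2 ?f' z = - pd 2 ?g (cnj z)"
        using pd_compose_cnj[OF d, of 1] pd_compose_cnj[OF d, of 2] by (simp_all add: o_def)
      ultimately show ?thesis
        by simp
    qed
    then show ?thesis
      using that[of "- 1"] by simp
  qed
  have "frame_axis ?f z = - (\<epsilon> * sin (3 * \<beta>)) *\<^sub>R v" if "z \<in> \<psi> ` U" for z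
    by (rule frame_axis_of_rotated_almost_complex[OF v _ _ \<epsilon> that pd[OF that]])
      (use inX rot perp in auto)
  then show "pd i (frame_axis ?f) z = 0"
    by (rule pd_eq_0_open[OF open_S z0])
qed

text \<open>
  The almost complex curve is \<open>\<phi>\<close> rotated by \<open>\<pi>/6\<close> about the constant axis. If it were contained in a proper
  subspace of the complement of the axis, some \<open>n \<noteq> 0\<close> in that complement would be orthogonal to it, and
  rotating \<open>n\<close> back would give a vector excluded by \<open>full_if_not_totally_geodesic\<close>.
\<close>

lemma axis_stationary_imp:
  assumes "axis_stationary A \<phi>" and ntg: "\<not> totally_geodesic A \<phi>"
  shows "\<exists>v \<beta> \<phi>'. norm v = 1 \<and> almost_complex_curve X A \<phi>' \<and> type_III X \<phi>' \<and>
           \<phi>' ` topspace X \<subseteq> sphere 0 1 \<inter> {x. x \<bullet> v = 0} \<and>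
           (\<forall>p\<in>topspace X. \<phi> p = rot7 v \<beta> (\<phi>' p))"
proof -
  obtain v where const: "in_coords A (\<lambda>g z. frame_axis g z = v) \<phi>"
    using stationary_imp_constant_axis[OF assms(1)] by blast
  note axis = in_coordsD[OF const]
  obtain U \<psi> z i j where c: "(U, \<psi>) \<in> A" and z: "z \<in> \<psi> ` U"
    and ff: "sphere_second_ff (\<phi> \<circ> inv_into U \<psi>) z i j \<noteq> 0"
    using ntg unfolding totally_geodesic_def in_coords_iff by blast
  let ?f = "\<phi> \<circ> inv_into U \<psi>"
  interpret totally_real_minimal_chart "\<psi> ` U" ?f
    by (rule minimal_chart[OF c])
  have v: "norm v = 1"
    using frame_axis(4)[OF z] by (simp add: axis[OF c z] norm_eq_1)
  define \<phi>' where "\<phi>' = (\<lambda>p. rot7 v (pi / 6) (\<phi> p))"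
  have unrot: "\<phi> q = rot7 v (- (pi / 6)) (\<phi>' q)" for q
    by (simp add: \<phi>'_def rot7_rot7[OF v])
  have sphere: "\<phi> q \<bullet> \<phi> q = 1" and perp: "\<phi> q \<bullet> v = 0" if q: "q \<in> topspace X" for q
  proof -
    obtain V \<eta> where V: "(V, \<eta>) \<in> A" "q \<in> V"
      by (rule chart_exists[OF q])
    then have \<eta>: "\<eta> q \<in> \<eta> ` V" "inv_into V \<eta> (\<eta> q) = q"
      using chart(4)[OF V(1)] by auto
    show "\<phi> q \<bullet> \<phi> q = 1" "\<phi> q \<bullet> v = 0"
      using totally_real_minimal_chart.unit[OF minimal_chart[OF V(1)] \<eta>(1)]
        totally_real_minimal_chart.frame_axis(1)[OF minimal_chart[OF V(1)] \<eta>(1)]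
      by (simp_all add: axis[OF V(1) \<eta>(1)] \<eta>(2) inner_commute)
  qed
  have image: "\<phi>' ` topspace X \<subseteq> sphere 0 1 \<inter> {x. x \<bullet> v = 0}"
    using sphere perp by (auto simp: \<phi>'_def norm_eq_1 inner_rot7_rot7[OF v] rot7_inner_axis[OF v])
  have inX: "inv_into U \<psi> z \<in> topspace X" if "z \<in> \<psi> ` U" for z
    using chart(2)[OF c] inv_into_into[OF that] by blast
  have full: "type_III X \<phi>'"
    unfolding type_III_def
  proof (intro exI[of _ "{x. v \<bullet> x = 0}"] conjI allI impI notI)
    show "subspace {x. v \<bullet> x = 0}"
      by (rule subspace_hyperplane)
    show "dim {x. v \<bullet> x = 0} = 6"
      using v dim_hyperplane[of v] by force
    show "\<phi>' ` topspace X \<subseteq> {x. v \<bullet> x = 0}"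
      using image by (auto simp: inner_commute)
    fix W
    assume W: "subspace W \<and> W \<subset> {x. v \<bullet> x = 0}" and sub: "\<phi>' ` topspace X \<subseteq> W"
    then have "span W \<subset> span {x. v \<bullet> x = 0}"
      by (simp add: span_eq_iff[THEN iffD2] subspace_hyperplane)
    then obtain n where n: "n \<noteq> 0" "n \<in> span {x. v \<bullet> x = 0}" "\<And>y. y \<in> span W \<Longrightarrow> orthogonal n y"
      using orthogonal_to_subspace_exists_gen[of W "{x. v \<bullet> x = 0}"] by metis
    have "span {x. v \<bullet> x = 0} = {x. v \<bullet> x = 0}"
      by (simp only: span_eq_iff subspace_hyperplane)
    with n(2) have "n \<in> {x. v \<bullet> x = 0}"
      by (simp only:)
    then have nv: "n \<bullet> v = 0"
      by (simp add: inner_commute)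
    let ?n = "rot7 v (- (pi / 6)) n"
    have "?n = 0"
    proof (rule full_if_not_totally_geodesic[OF axis[OF c] z ff])
      show "?n \<bullet> v = 0"
        using nv by (simp add: rot7_inner_axis[OF v])
      show "?n \<bullet> ?f z = 0" if "z \<in> \<psi> ` U" for z
      proof -
        have "\<phi>' (inv_into U \<psi> z) \<in> W"
          using sub inX[OF that] by blast
        then show ?thesis
          using n(3)[OF span_base] by (simp add: inner_rot7 orthogonal_def \<phi>'_def)
      qed
    qed
    then have "?n \<bullet> ?n = 0"
      by simp
    then show False
      using n(1) by (simp only: inner_rot7_rot7[OF v] inner_eq_zero_iff)
  qed
  have ac: "almost_complex_curve X A \<phi>'"
    unfolding almost_complex_curve_def
  proof (intro conjI notI)
    show "\<phi>' ` topspace X \<subseteq> sphere 0 1"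
      using image by blast
    show "smooth_map A \<phi>'"
      unfolding smooth_map_def
    proof clarify
      fix V \<eta> k
      assume V: "(V, \<eta>) \<in> A"
      interpret V: totally_real_minimal_chart "\<eta> ` V" "\<phi> \<circ> inv_into V \<eta>"
        by (rule minimal_chart[OF V])
      show "Ck_on k (\<eta> ` V) (\<phi>' \<circ> inv_into V \<eta>)"
        using bounded_linear.Ck_on_linear[OF bounded_linear_rot7[of v "pi / 6"] V.open_S V.smooth]
        by (simp add: \<phi>'_def o_def)
    qed
    show "in_coords A (\<lambda>g z. pd 2 g z = cross7 (g z) (pd 1 g z)) \<phi>'"
    proof (rule in_coordsI)
      fix V \<eta> z
      assume V: "(V, \<eta>) \<in> A" "z \<in> \<eta> ` V"
      show "pd 2 (\<phi>' \<circ> inv_into V \<eta>) z = cross7 ((\<phi>' \<circ> inv_into V \<eta>) z) (pd 1 (\<phi>' \<circ> inv_into V \<eta>) z)"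
        using totally_real_minimal_chart.rotation_almost_complex[OF minimal_chart[OF V(1)] V(2) axis[OF V]]
        by (simp add: \<phi>'_def o_def)
    qed
    assume "\<phi>' constant_on topspace X"
    then obtain a where "\<And>q. q \<in> topspace X \<Longrightarrow> \<phi>' q = a"
      unfolding constant_on_def by blast
    then have "?f z = rot7 v (- (pi / 6)) a" if "z \<in> \<psi> ` U" for z
      using unrot[of "inv_into U \<psi> z"] inX[OF that] by simp
    then have "pd 1 ?f z = 0"
      by (rule pd_eq_0_open[OF open_S z])
    then show False
      using immersed[OF z] by blast
  qed
  show ?thesis
    using v ac full image unrot by blast
qed

context
  fixes F :: "'a \<Rightarrow> real ^ 7"
  assumes primitive: "is_cross_star_primitive A \<phi> F"
begin

lemma primitive_chart:
  assumes c: "(U, \<psi>) \<in> A"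
  shows "totally_real_primitive (\<psi> ` U) (\<phi> \<circ> inv_into U \<psi>) (F \<circ> inv_into U \<psi>)"
proof -
  interpret totally_real_minimal_chart "\<psi> ` U" "\<phi> \<circ> inv_into U \<psi>"
    by (rule minimal_chart[OF c])
  have P: "(F \<circ> inv_into U \<psi>) differentiable (at z) \<and>
     pd 1 (F \<circ> inv_into U \<psi>) z = cross7 ((\<phi> \<circ> inv_into U \<psi>) z) (pd 2 (\<phi> \<circ> inv_into U \<psi>) z) \<and>
     pd 2 (F \<circ> inv_into U \<psi>) z = - cross7 ((\<phi> \<circ> inv_into U \<psi>) z) (pd 1 (\<phi> \<circ> inv_into U \<psi>) z)"
    if "z \<in> \<psi> ` U" for z
    using primitive c that unfolding is_cross_star_primitive_def Let_def by fast
  show ?thesis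
    by unfold_locales (use P in blast)+
qed

lemma conformal_immersion_parallel_surface:
  assumes \<sigma>: "\<sigma> = 1 \<or> \<sigma> = - 1"
  shows "conformal_immersion A (\<lambda>p. F p + \<sigma> *\<^sub>R \<phi> p)"
proof -
  have comp: "(\<lambda>p. F p + \<sigma> *\<^sub>R \<phi> p) \<circ> inv_into U \<psi>
      = (\<lambda>z. (F \<circ> inv_into U \<psi>) z + \<sigma> *\<^sub>R (\<phi> \<circ> inv_into U \<psi>) z)" for U and \<psi> :: "'a \<Rightarrow> complex"
    by (simp add: fun_eq_iff)
  have "smooth_map A (\<lambda>p. F p + \<sigma> *\<^sub>R \<phi> p)"
    unfolding smooth_map_def comp
    using totally_real_primitive.smooth_H[OF primitive_chart \<sigma>] by fast
  moreover have "in_coords A (\<lambda>g z. inj (frechet_derivative g (at z))) (\<lambda>p. F p + \<sigma> *\<^sub>R \<phi> p)"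
    by (rule in_coordsI, unfold comp)
      (rule totally_real_primitive.H_immersion[OF primitive_chart \<sigma>])
  moreover have "in_coords A (\<lambda>g z. pd 1 g z \<bullet> pd 2 g z = 0 \<and> norm (pd 1 g z) = norm (pd 2 g z)) (\<lambda>p. F p + \<sigma> *\<^sub>R \<phi> p)"
  proof (rule in_coordsI, unfold comp)
    fix U \<psi> z
    assume c: "(U, \<psi>) \<in> A" "z \<in> \<psi> ` U"
    note H = totally_real_primitive.H_conformal[OF primitive_chart[OF c(1)] \<sigma> c(2)]
    show "pd 1 (\<lambda>z. (F \<circ> inv_into U \<psi>) z + \<sigma> *\<^sub>R (\<phi> \<circ> inv_into U \<psi>) z) z
          \<bullet> pd 2 (\<lambda>z. (F \<circ> inv_into U \<psi>) z + \<sigma> *\<^sub>R (\<phi> \<circ> inv_into U \<psi>) z) z = 0 \<and>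
        norm (pd 1 (\<lambda>z. (F \<circ> inv_into U \<psi>) z + \<sigma> *\<^sub>R (\<phi> \<circ> inv_into U \<psi>) z) z)
          = norm (pd 2 (\<lambda>z. (F \<circ> inv_into U \<psi>) z + \<sigma> *\<^sub>R (\<phi> \<circ> inv_into U \<psi>) z) z)"
      by (simp only: H norm_eq_sqrt_inner simp_thms)
  qed
  ultimately show ?thesis
    by (simp add: conformal_immersion_def)
qed

lemma parallel_both_iff_axis_stationary:
  "parallel_mean_curvature A (\<lambda>p. F p + 1 *\<^sub>R \<phi> p) \<and> parallel_mean_curvature A (\<lambda>p. F p + (- 1) *\<^sub>R \<phi> p)
    \<longleftrightarrow> axis_stationary A \<phi>"
proof -
  have comp: "(\<lambda>p. F p + \<sigma> *\<^sub>R \<phi> p) \<circ> inv_into U \<psi>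
      = (\<lambda>z. (F \<circ> inv_into U \<psi>) z + \<sigma> *\<^sub>R (\<phi> \<circ> inv_into U \<psi>) z)" for U and \<psi> :: "'a \<Rightarrow> complex" and \<sigma> :: real
    by (simp add: fun_eq_iff)
  have iff: "(\<forall>i. normal_part (tangent_basis ((\<lambda>p. F p + 1 *\<^sub>R \<phi> p) \<circ> inv_into U \<psi>) z)
          (pd i (mean_curvature ((\<lambda>p. F p + 1 *\<^sub>R \<phi> p) \<circ> inv_into U \<psi>)) z) = 0)
      \<and> (\<forall>i. normal_part (tangent_basis ((\<lambda>p. F p + (- 1) *\<^sub>R \<phi> p) \<circ> inv_into U \<psi>) z)
          (pd i (mean_curvature ((\<lambda>p. F p + (- 1) *\<^sub>R \<phi> p) \<circ> inv_into U \<psi>)) z) = 0)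
      \<longleftrightarrow> (\<forall>i. pd i (frame_axis (\<phi> \<circ> inv_into U \<psi>)) z = 0)"
    if "(U, \<psi>) \<in> A" "z \<in> \<psi> ` U" for U \<psi> z
    unfolding comp by (rule totally_real_primitive.parallel_both_iff[OF primitive_chart[OF that(1)] that(2)])
  show ?thesis
    unfolding parallel_mean_curvature_def axis_stationary_def
    by (rule in_coords_conj_cong) (rule iff)
qed

end
end
end

theorem theorem6:
  fixes X :: "'a topology" and A :: "'a atlas" and \<phi> F :: "'a \<Rightarrow> real ^ 7"
  assumes "riemann_surface X A"
    and "totally_real_minimal_immersion X A \<phi>"
    and "is_cross_star_primitive A \<phi> F"
  shows "conformal_immersion A (\<lambda>p. F p + \<phi> p) \<and>
    conformal_immersion A (\<lambda>p. F p - \<phi> p) \<and>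
    (parallel_mean_curvature A (\<lambda>p. F p + \<phi> p) \<and> parallel_mean_curvature A (\<lambda>p. F p - \<phi> p) \<longleftrightarrow>
      (\<exists>B\<in>{A, conj_atlas A}.
        (\<exists>v \<beta> \<phi>'. norm v = 1 \<and>
           almost_complex_curve X B \<phi>' \<and> type_III X \<phi>' \<and>
           \<phi>' ` topspace X \<subseteq> sphere 0 1 \<inter> {x. x \<bullet> v = 0} \<and>
           (\<forall>p\<in>topspace X. \<phi> p = rot7 v \<beta> (\<phi>' p))) \<or>
        totally_geodesic B \<phi>))"
proof -
  have "conformal_immersion A (\<lambda>p. F p + \<phi> p)" "conformal_immersion A (\<lambda>p. F p - \<phi> p)"
    using conformal_immersion_parallel_surface[OF assms, of 1]
      conformal_immersion_parallel_surface[OF assms, of "- 1"] by simp_all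
  moreover have "parallel_mean_curvature A (\<lambda>p. F p + \<phi> p) \<and> parallel_mean_curvature A (\<lambda>p. F p - \<phi> p)
      \<longleftrightarrow> axis_stationary A \<phi>"
    using parallel_both_iff_axis_stationary[OF assms] by simp
  moreover have "axis_stationary A \<phi> \<longleftrightarrow> (\<exists>B\<in>{A, conj_atlas A}.
        (\<exists>v \<beta> \<phi>'. norm v = 1 \<and>
           almost_complex_curve X B \<phi>' \<and> type_III X \<phi>' \<and>
           \<phi>' ` topspace X \<subseteq> sphere 0 1 \<inter> {x. x \<bullet> v = 0} \<and>
           (\<forall>p\<in>topspace X. \<phi> p = rot7 v \<beta> (\<phi>' p))) \<or>
        totally_geodesic B \<phi>)" (is "_ \<longleftrightarrow> ?R")
  proof
    assume stationary: "axis_stationary A \<phi>"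
    show ?R
    proof (cases "totally_geodesic A \<phi>")
      case True
      show ?R
        by (rule bexI[of _ A], rule disjI2, rule True, simp)
    next
      case False
      show ?R
        by (rule bexI[of _ A], rule disjI1, rule axis_stationary_imp[OF assms(1,2) stationary False], simp)
    qed
  next
    assume ?R
    then obtain B where B: "B \<in> {A, conj_atlas A}"
      and "(\<exists>v \<beta> \<phi>'. norm v = 1 \<and> almost_complex_curve X B \<phi>' \<and> type_III X \<phi>' \<and>
           \<phi>' ` topspace X \<subseteq> sphere 0 1 \<inter> {x. x \<bullet> v = 0} \<and>
           (\<forall>p\<in>topspace X. \<phi> p = rot7 v \<beta> (\<phi>' p))) \<or> totally_geodesic B \<phi>"
      by (rule bexE)
    from this(2) show "axis_stationary A \<phi>"
    proof (elim disjE exE conjE)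
      assume "totally_geodesic B \<phi>"
      with B show ?thesis
        by (rule totally_geodesic_axis_stationary[OF assms(1,2)])
    next
      fix v \<beta> \<phi>'
      assume "norm v = 1" "almost_complex_curve X B \<phi>'" and "\<phi>' ` topspace X \<subseteq> sphere 0 1 \<inter> {x. x \<bullet> v = 0}"
        and "\<forall>p\<in>topspace X. \<phi> p = rot7 v \<beta> (\<phi>' p)"
      then show ?thesis
        by (intro rotated_almost_complex_axis_stationary[OF assms(1,2) B, of v \<phi>' \<beta>]) auto
    qed
  qed
  ultimately show ?thesis
    by simp
qed


end
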